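(* Let $M$ be a compact metric space, $\pi,\nu\in\mathcal P(M)$, $K$ the support of $\nu$, and $G:M\times M\to(-\infty,\infty]$ a lower semicontinuous function. Suppose that $(G,K)$ is regular and that $(G,\nu)$ satisfies the Bernstein–Markov condition. Suppose also that for every $\mu\in\mathcal P(M)$ with $\int_{M\times M}G(x,y)\,d\mu(x)d\mu(y)<\infty$ there exists a sequence $\{\mu_n\}_{n\in\mathbb N}$ in $\mathcal P(M)$ such that $D(\mu_n\|\pi)<\infty$ for every $n\in\mathbb N$ and $$\lim_{n\to\infty}\int_{M\times M}G(x,y)\,d\mu_n(x)d\mu_n(y)=\int_{M\times M}G(x,y)\,d\mu(x)d\mu(y).$$ Define $w_n:M^n\to(-\infty,\infty]$ and $w:\mathcal P(M)\to(-\infty,\infty]$ by $$w_n(z_1,\dots,z_n)=\frac1{n^2}\sum_{i<j}G(z_i,z_j)+\frac{n+1}{n^2}\log\left(\int_Me^{-\sum_{i=1}^nG(z,z_i)}\,d\nu(z)\right),$$ $$w(\mu)=\frac12\int_{M\times M}G(x,y)\,d\mu(x)d\mu(y)-\inf_{x\in K}\left\{\int_MG(x,y)\,d\mu(y)\right\}.$$ Then $w$ is the zero temperature macroscopic limit of $\{w_n\}_{n\in\mathbb N}$.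
   Context: $\mathcal P(M)$ carries the weak topology. $D(\mu\|\pi)=\int\frac{d\mu}{d\pi}\log\frac{d\mu}{d\pi}\,d\pi$ if $\mu\ll\pi$ and $\infty$ otherwise. Bernstein–Markov condition for $(G,\nu)$: for $\vec x=(x_1,\dots,x_n)\in M^n$ let $s_{\vec x}(y)=e^{-\sum_{i=1}^nG(x_i,y)}$; for every $\epsilon>0$ there is $C>0$ such that $\sup_{y\in K}s_{\vec x}(y)\le Ce^{\epsilon n}\|s_{\vec x}\|_{L^1(M,\nu)}$ for every $n>0$ and every $\vec x\in M^n$. $(G,K)$ is regular if for every $\mu\in\mathcal P(M)$ and every $\epsilon>0$ there is $\sigma\in\mathcal P(M)$ such that $\sigma\big(\{x\in K:\int_MG(x,y)d\mu(y)\le\inf_{z\in K}\int_MG(z,y)d\mu(y)+\epsilon\}\big)=1$ and $x\mapsto\int_MG(x,y)\,d\sigma(y)$ is finite and continuous. Energies $w_n:M^n\to(-\infty,\infty]$ whose macroscopic limit is considered are, as a standing convention, symmetric measurable functions. For such $w_n$ define $\tilde w_n(\mu)=w_n(x_1,\dots,x_n)$ if $\mu=\frac1n\sum_{i=1}^n\delta_{x_i}$ and $\tilde w_n(\mu)=\infty$ if $\mu\in\mathcal P(M)$ is not of this form. A measurable $w:\mathcal P(M)\to(-\infty,\infty]$ is the zero temperature macroscopic limit of $\{w_n\}$ if: $\{w_n\}$ is stable, i.e. $w_n\ge C$ for all $n$ for some $C\in\mathbb R$; (A1) $\mu_n\to\mu$ implies $\liminf_n\tilde w_n(\mu_n)\ge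 w(\mu)$; and (A2') for every $\mu$ with $w(\mu)<\infty$ there are $\mu_n\in\mathcal N$ with $\mu_n\to\mu$ and $\limsup_nw(\mu_n)\le w(\mu)$, where $\mathcal N=\{\mu\in\mathcal P(M):D(\mu\|\pi)<\infty,\ \limsup_n\mathbb E_{\mu^{\otimes n}}[w_n]\le w(\mu)\}$.
   Formalization: The approximating sequence is also required to converge weakly to μ (without this the claim fails, e.g. M={a,b}, π=ν=δ_a, G=0), and G is assumed symmetric, which the convention that the w_n are symmetric forces. *)

theory Defs
  imports "HOL-Probability.Probability"
begin

section \<open>Extended-real integrals and functions\<close>

text \<open>Positive part minus negative part.  Every integrand considered below is bounded below
  and every measure is a probability measure, so the negative part has a finite integral and
  no \<open>\<infinity> - \<infinity>\<close> occurs.\<close>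

definition ext_integral :: "'a measure \<Rightarrow> ('a \<Rightarrow> ereal) \<Rightarrow> ereal" where
  "ext_integral M f =
     enn2ereal (\<integral>\<^sup>+ x. e2ennreal (f x) \<partial>M) - enn2ereal (\<integral>\<^sup>+ x. e2ennreal (- f x) \<partial>M)"

definition exp_ereal :: "ereal \<Rightarrow> ennreal" where
  "exp_ereal t = (case t of ereal r \<Rightarrow> ennreal (exp r) | PInfty \<Rightarrow> \<top> | MInfty \<Rightarrow> 0)"

definition ln_ennreal :: "ennreal \<Rightarrow> ereal" where
  "ln_ennreal t = (if t = 0 then - \<infinity> else if t = \<top> then \<infinity> else ereal (ln (enn2real t)))"

definition lower_semicontinuous :: "('a::topological_space \<Rightarrow> ereal) \<Rightarrow> bool" where
  "lower_semicontinuous f \<longleftrightarrow> (\<forall>a. open {x. a < f x})"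


section \<open>Probability measures with the weak topology\<close>

definition prob_measures :: "'a::topological_space measure set" where
  "prob_measures = {\<mu>. prob_space \<mu> \<and> sets \<mu> = sets borel}"

text \<open>The coarsest topology making \<open>\<mu> \<mapsto> \<integral>f d\<mu>\<close> continuous for every bounded continuous \<open>f\<close>.\<close>

definition weak_topology :: "'a::topological_space measure topology" where
  "weak_topology = topology_generated_by
     {{\<mu> \<in> prob_measures. (\<integral>x. f x \<partial>\<mu>) \<in> U} | (f :: 'a \<Rightarrow> real) U.
        continuous_on UNIV f \<and> bounded (range f) \<and> open U}"

definition weak_borel :: "'a::topological_space measure measure" where
  "weak_borel = sigma prob_measures {A. openin weak_topology A}"

definition measure_support :: "'a::topological_space measure \<Rightarrow> 'a set" where
  "measure_support \<nu> = {x. \<forall>U. open U \<and> x \<in> U \<longrightarrow> emeasure \<nu> U > 0}"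

text \<open>The relative entropy \<open>D(\<mu>\<parallel>\<pi>)\<close>, first argument \<open>\<mu>\<close>.  The library's
  \<^const>\<open>KL_divergence\<close> is real-valued and never infinite, hence not usable here.\<close>

definition rel_entropy :: "'a measure \<Rightarrow> 'a measure \<Rightarrow> ereal" where
  "rel_entropy \<mu> \<pi> =
     (if absolutely_continuous \<pi> \<mu>
      then ext_integral \<pi> (\<lambda>x. let r = enn2real (RN_deriv \<pi> \<mu> x) in ereal (r * ln r))
      else \<infinity>)"


section \<open>Zero temperature macroscopic limits\<close>

text \<open>Points of \<open>M\<^sup>n\<close> are extensional functions on \<open>{..<n}\<close>, so the coordinates are
  \<open>x 0, \<dots>, x (n - 1)\<close>.\<close>

abbreviation power_space :: "nat \<Rightarrow> (nat \<Rightarrow> 'a::topological_space) measure" where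
  "power_space n \<equiv> PiM {..<n} (\<lambda>_. borel)"

text \<open>\<open>(1/n) (\<delta>\<^bsub>x 0\<^esub> + \<dots> + \<delta>\<^bsub>x (n - 1)\<^esub>)\<close>, as the image under \<open>x\<close> of
  the uniform distribution on \<open>{..<n}\<close>.\<close>

definition empirical_measure :: "nat \<Rightarrow> (nat \<Rightarrow> 'a::topological_space) \<Rightarrow> 'a measure" where
  "empirical_measure n x = distr (uniform_count_measure {..<n}) borel x"

lemma emeasure_empirical_measure:
  assumes "n > 0" "A \<in> sets borel"
  shows "emeasure (empirical_measure n x) A = ennreal ((\<Sum>i<n. indicator A (x i)) / real n)"
proof -
  have "emeasure (empirical_measure n x) A =
      emeasure (uniform_count_measure {..<n}) (x -` A \<inter> {..<n})"
    unfolding empirical_measure_def using assms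
    by (subst emeasure_distr)
       (auto simp: measurable_def space_uniform_count_measure sets_uniform_count_measure)
  also have "\<dots> = ennreal (card (x -` A \<inter> {..<n}) / real n)"
    using assms by (subst emeasure_uniform_count_measure) auto
  also have "real (card (x -` A \<inter> {..<n})) = (\<Sum>i<n. indicator A (x i))"
    by (simp add: indicator_def sum.If_cases Int_def vimage_def conj_commute)
  finally show ?thesis .
qed

definition energy_function :: "nat \<Rightarrow> ((nat \<Rightarrow> 'a::topological_space) \<Rightarrow> ereal) \<Rightarrow> bool" where
  "energy_function n f \<longleftrightarrow>
     f \<in> borel_measurable (power_space n) \<and>
     (\<forall>x \<in> space (power_space n). f x \<noteq> - \<infinity>) \<and>
     (\<forall>x \<in> space (power_space n). \<forall>p. p permutes {..<n} \<longrightarrow> f (x \<circ> p) = f x)"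

text \<open>For symmetric \<open>f\<close> the value does not depend on the chosen \<open>x\<close>, because the empirical
  measure determines \<open>x\<close> up to a permutation.\<close>

definition lift_energy ::
  "nat \<Rightarrow> ((nat \<Rightarrow> 'a::topological_space) \<Rightarrow> ereal) \<Rightarrow> 'a measure \<Rightarrow> ereal" where
  "lift_energy n f \<mu> =
     (if \<exists>x \<in> space (power_space n). \<mu> = empirical_measure n x
      then f (SOME x. x \<in> space (power_space n) \<and> \<mu> = empirical_measure n x)
      else \<infinity>)"

definition recovery_measures ::
  "'a::topological_space measure \<Rightarrow> (nat \<Rightarrow> (nat \<Rightarrow> 'a) \<Rightarrow> ereal) \<Rightarrow> ('a measure \<Rightarrow> ereal) \<Rightarrow>
   'a measure set" where
  "recovery_measures \<pi> wn w =
     {\<mu> \<in> prob_measures. rel_entropy \<mu> \<pi> < \<infinity> \<and>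
        limsup (\<lambda>n. ext_integral (PiM {..<n} (\<lambda>_. \<mu>)) (wn n)) \<le> w \<mu>}"

text \<open>The number of particles ranges over the positive integers; \<open>wn 0\<close> plays no role.\<close>

definition zero_temp_macroscopic_limit ::
  "'a::topological_space measure \<Rightarrow> (nat \<Rightarrow> (nat \<Rightarrow> 'a) \<Rightarrow> ereal) \<Rightarrow> ('a measure \<Rightarrow> ereal) \<Rightarrow>
   bool" where
  "zero_temp_macroscopic_limit \<pi> wn w \<longleftrightarrow>
     (\<forall>n>0. energy_function n (wn n)) \<and>
     w \<in> borel_measurable weak_borel \<and> (\<forall>\<mu> \<in> prob_measures. w \<mu> \<noteq> - \<infinity>) \<and>
     (\<exists>C::real. \<forall>n>0. \<forall>x \<in> space (power_space n). ereal C \<le> wn n x) \<and>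
     (\<forall>\<mu>s \<mu>. (\<forall>n. \<mu>s n \<in> prob_measures) \<and> limitin weak_topology \<mu>s \<mu> sequentially \<longrightarrow>
        w \<mu> \<le> liminf (\<lambda>n. lift_energy n (wn n) (\<mu>s n))) \<and>
     (\<forall>\<mu> \<in> prob_measures. w \<mu> < \<infinity> \<longrightarrow>
        (\<exists>\<mu>s. (\<forall>n. \<mu>s n \<in> recovery_measures \<pi> wn w) \<and>
           limitin weak_topology \<mu>s \<mu> sequentially \<and> limsup (\<lambda>n. w (\<mu>s n)) \<le> w \<mu>))"


section \<open>Kernels, potentials and the conditional energies\<close>

definition potential :: "('a \<Rightarrow> 'a \<Rightarrow> ereal) \<Rightarrow> 'a measure \<Rightarrow> 'a \<Rightarrow> ereal" where
  "potential G \<mu> x = ext_integral \<mu> (\<lambda>y. G x y)"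

definition interaction_energy :: "('a \<Rightarrow> 'a \<Rightarrow> ereal) \<Rightarrow> 'a measure \<Rightarrow> ereal" where
  "interaction_energy G \<mu> = ext_integral (\<mu> \<Otimes>\<^sub>M \<mu>) (\<lambda>(x, y). G x y)"

definition regular_pair :: "('a::topological_space \<Rightarrow> 'a \<Rightarrow> ereal) \<Rightarrow> 'a set \<Rightarrow> bool" where
  "regular_pair G K \<longleftrightarrow>
     (\<forall>\<mu> \<in> prob_measures. \<forall>\<epsilon>::real. \<epsilon> > 0 \<longrightarrow>
        (\<exists>\<sigma> \<in> prob_measures.
           emeasure \<sigma> {x \<in> K. potential G \<mu> x \<le> (INF z\<in>K. potential G \<mu> z) + ereal \<epsilon>} = 1 \<and>
           (\<forall>x. \<bar>potential G \<sigma> x\<bar> \<noteq> \<infinity>) \<and> continuous_on UNIV (potential G \<sigma>)))"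

definition section_density ::
  "('a \<Rightarrow> 'a \<Rightarrow> ereal) \<Rightarrow> nat \<Rightarrow> (nat \<Rightarrow> 'a) \<Rightarrow> 'a \<Rightarrow> ennreal" where
  "section_density G n x y = exp_ereal (- (\<Sum>i<n. G (x i) y))"

text \<open>\<open>K\<close> is meant to be the support of \<open>\<nu>\<close>.\<close>

definition bernstein_markov ::
  "('a::topological_space \<Rightarrow> 'a \<Rightarrow> ereal) \<Rightarrow> 'a set \<Rightarrow> 'a measure \<Rightarrow> bool" where
  "bernstein_markov G K \<nu> \<longleftrightarrow>
     (\<forall>\<epsilon>::real. \<epsilon> > 0 \<longrightarrow> (\<exists>C::real. C > 0 \<and>
        (\<forall>n>0. \<forall>x \<in> space (power_space n).
           (SUP y\<in>K. section_density G n x y)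
             \<le> ennreal (C * exp (\<epsilon> * real n)) * (\<integral>\<^sup>+ y. section_density G n x y \<partial>\<nu>))))"

definition conditional_energy ::
  "('a \<Rightarrow> 'a \<Rightarrow> ereal) \<Rightarrow> 'a measure \<Rightarrow> nat \<Rightarrow> (nat \<Rightarrow> 'a) \<Rightarrow> ereal" where
  "conditional_energy G \<nu> n z =
     ereal (1 / real n ^ 2) * (\<Sum>j<n. \<Sum>i<j. G (z i) (z j)) +
     ereal (real (n + 1) / real n ^ 2) *
       ln_ennreal (\<integral>\<^sup>+ y. exp_ereal (- (\<Sum>i<n. G y (z i))) \<partial>\<nu>)"

definition conditional_limit ::
  "('a \<Rightarrow> 'a \<Rightarrow> ereal) \<Rightarrow> 'a set \<Rightarrow> 'a measure \<Rightarrow> ereal" where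
  "conditional_limit G K \<mu> =
     ereal (1 / 2) * interaction_energy G \<mu> - (INF x\<in>K. potential G \<mu> x)"

end

theory Submission
  imports Defs "HOL-Real_Asymp.Real_Asymp"
begin

text \<open>Write \<open>I(\<mu>)\<close> for the infimum over \<open>K\<close> of the potential of \<open>\<mu>\<close>.  Call \<open>\<sigma>\<close> a test measure
  if it is carried by \<open>K\<close> and has a finite continuous potential \<open>U\<^sub>\<sigma>\<close>.  By reciprocity and regularity
  \<open>I(\<mu>)\<close> is the infimum of \<open>\<integral> U\<^sub>\<sigma> d\<mu>\<close> over all test measures.  Hence, if \<open>f\<^sub>k\<close> are continuous symmetric
  kernels increasing to \<open>G\<close>, the limit functional is the supremum of the weakly continuous functionals
  \<open>\<mu> \<mapsto> (\<integral>\<integral> f\<^sub>k d\<mu> d\<mu>) / 2 - \<integral> U\<^sub>\<sigma> d\<mu>\<close>.  The Bernstein-Markov condition bounds the conditional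
  energy of \<open>n\<close> particles below by each of these at the empirical measure, up to an error vanishing
  with \<open>n\<close>, which gives stability and the lower bound.

  For the upper bound, Dini's theorem and equicontinuity of \<open>f\<^sub>k\<close> control \<open>I\<close> from below by finitely many
  integrals of continuous functions.  This makes \<open>I\<close> lower semicontinuous, and an \<open>L\<^sup>2\<close> law of large
  numbers for these functions bounds the expected conditional energy under \<open>\<mu>\<^sup>\<otimes>\<^sup>n\<close>.\<close>

section \<open>Extended integrals of functions bounded below\<close>

text \<open>A potential of \<open>G\<close> is only lower semicontinuous, and an infimum of such
  potentials enters the limit with a minus sign: the wrong direction for the lower bound. Regularity
  repairs this, because the test measures present the infimum from above by weakly continuous
  functionals. Combined with the compactness argument of the upper bound, the infimum is weakly
  continuous, and only the energy is genuinely semicontinuous. The second obstacle is the diagonal.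
  The double integral of \<open>G\<close> against an empirical measure contains the values
  \<open>G (z i) (z i)\<close>, possibly infinite, while the pair sum runs over i < j. Replacing
  \<open>G\<close> by \<open>f k\<close>, which is at most k, limits the cost of the diagonal to
  k/(2n), and this vanishes while k is fixed. Under a product measure only distinct coordinates
  meet, and these are independent. The logarithm is scaled so that an integral of size exp(-n I)
  contributes -(1 + 1/n) I. Bernstein-Markov supplies the lower estimate of this integral; the upper
  one holds because \<open>\<nu>\<close> is carried by its support.\<close>

lemma e2ennreal_add_const:
  assumes "ereal (- B) \<le> t" "0 \<le> B"
  shows "e2ennreal t + ennreal B = e2ennreal (t + ereal B) + e2ennreal (- t)"
proof (cases t)
  case (real r)
  show ?thesis
  proof (cases "0 \<le> r")
    case True
    then show ?thesis using real assms by (simp add: ennreal_plus ennreal_neg)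
  next
    case False
    then have "ennreal B = ennreal (r + B) + ennreal (- r)"
      using real assms by (subst ennreal_plus[symmetric]) auto
    with False show ?thesis using real by (simp add: ennreal_neg)
  qed
qed (use assms in \<open>auto simp: e2ennreal_neg\<close>)

text \<open>Integrates the pointwise identity \<open>e2ennreal_add_const\<close>, which is t = t^+ -
  t^- with every subtraction moved across. The result is one nonnegative integral up to a constant,
  the form to which monotone convergence applies.\<close>

lemma ext_integral_bounded_below:
  assumes "prob_space M" and [measurable]: "f \<in> borel_measurable M"
    and B: "\<And>x. x \<in> space M \<Longrightarrow> ereal (- B) \<le> f x" "0 \<le> B"
  shows "ext_integral M f = enn2ereal (\<integral>\<^sup>+ x. e2ennreal (f x + ereal B) \<partial>M) - ereal B"
proof -
  interpret prob_space M by fact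
  let ?p = "\<integral>\<^sup>+ x. e2ennreal (f x) \<partial>M" and ?q = "\<integral>\<^sup>+ x. e2ennreal (- f x) \<partial>M"
  let ?s = "\<integral>\<^sup>+ x. e2ennreal (f x + ereal B) \<partial>M"
  have "?p + ennreal B = (\<integral>\<^sup>+ x. e2ennreal (f x) + ennreal B \<partial>M)"
    by (subst nn_integral_add) (auto simp: emeasure_space_1)
  also have "\<dots> = (\<integral>\<^sup>+ x. e2ennreal (f x + ereal B) + e2ennreal (- f x) \<partial>M)"
    by (intro nn_integral_cong e2ennreal_add_const B)
  also have "\<dots> = ?s + ?q"
    by (subst nn_integral_add) auto
  finally have eq: "?p + ennreal B = ?s + ?q" .
  \<comment> \<open>The negative part is at most B, so \<open>?q\<close> is finite and may be
    cancelled from the extended-real equation.\<close>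
  have "?q \<le> (\<integral>\<^sup>+ x. ennreal B \<partial>M)"
  proof (intro nn_integral_mono)
    fix x assume "x \<in> space M"
    then have "- f x \<le> ereal B" using B(1)[of x] by (cases "f x") auto
    then show "e2ennreal (- f x) \<le> ennreal B" using e2ennreal_mono by fastforce
  qed
  then have "?q \<noteq> \<top>" by (auto simp: emeasure_space_1 top_unique)
  then obtain b where b: "?q = ennreal b" "0 \<le> b" by (cases ?q) auto
  have "enn2ereal ?p + ereal B = enn2ereal ?s + ereal b"
    using arg_cong[OF eq, of enn2ereal] b B by (simp add: plus_ennreal.rep_eq)
  then have "enn2ereal ?p - ereal b = enn2ereal ?s - ereal B"
    by (cases "enn2ereal ?p"; cases "enn2ereal ?s") auto
  then show ?thesis using b by (simp add: ext_integral_def)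
qed

lemma ext_integral_mono_AE:
  assumes "AE x in M. f x \<le> g x"
  shows "ext_integral M f \<le> ext_integral M g"
  unfolding ext_integral_def
proof (intro ereal_minus_mono)
  show "enn2ereal (\<integral>\<^sup>+ x. e2ennreal (f x) \<partial>M) \<le> enn2ereal (\<integral>\<^sup>+ x. e2ennreal (g x) \<partial>M)"
    unfolding less_eq_ennreal.rep_eq[symmetric]
    by (intro nn_integral_mono_AE) (use assms in \<open>auto intro: e2ennreal_mono\<close>)
  show "enn2ereal (\<integral>\<^sup>+ x. e2ennreal (- g x) \<partial>M) \<le> enn2ereal (\<integral>\<^sup>+ x. e2ennreal (- f x) \<partial>M)"
    unfolding less_eq_ennreal.rep_eq[symmetric]
    by (intro nn_integral_mono_AE) (use assms in \<open>auto intro!: e2ennreal_mono simp: ereal_minus_le_minus\<close>)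
qed

lemma ext_integral_ereal:
  assumes "integrable M f"
  shows "ext_integral M (\<lambda>x. ereal (f x)) = ereal (\<integral>x. f x \<partial>M)"
proof -
  obtain r q where "0 \<le> r" "0 \<le> q"
    "(\<integral>\<^sup>+ x. ennreal (f x) \<partial>M) = ennreal r" "(\<integral>\<^sup>+ x. ennreal (- f x) \<partial>M) = ennreal q"
    "integral\<^sup>L M f = r - q"
    using real_lebesgue_integral_def[OF assms] integrableE[OF assms] by metis
  then show ?thesis
    by (simp add: ext_integral_def)
qed

lemma ext_integral_const: "prob_space M \<Longrightarrow> ext_integral M (\<lambda>_. ereal c) = ereal c"
  using ext_integral_ereal[OF finite_measure.integrable_const[OF prob_space.finite_measure], of M c]
  by (simp add: prob_space.prob_space)

text \<open>After the shift by B this is monotone convergence for nonnegative functions. The upper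
  bound \<open>A k\<close> makes each approximant integrable and may grow with k, so the limit
  \<open>g\<close> can take the value infinity.\<close>

lemma ext_integral_monotone_convergence:
  fixes f :: "nat \<Rightarrow> 'a \<Rightarrow> real"
  assumes M: "prob_space M" and [measurable]: "\<And>k. f k \<in> borel_measurable M"
    and low: "\<And>k x. - B \<le> f k x" and B: "0 \<le> B"
    and up: "\<And>k x. f k x \<le> A k"
    and inc: "\<And>x. incseq (\<lambda>k. f k x)"
    and lim: "\<And>x. (\<lambda>k. ereal (f k x)) \<longlonglongrightarrow> g x"
  shows "(\<lambda>k. ereal (\<integral>x. f k x \<partial>M)) \<longlonglongrightarrow> ext_integral M g"
proof -
  interpret prob_space M by fact
  have [measurable]: "g \<in> borel_measurable M"
    by (rule borel_measurable_LIMSEQ_order[OF lim]) auto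
  have gB: "ereal (- B) \<le> g x" for x
    by (rule LIMSEQ_le_const[OF lim]) (use low in auto)
  have int: "integrable M (f k)" for k
  proof (rule integrable_const_bound[where B="max B (A k)"])
    have "norm (f k x) \<le> max B (A k)" for x
      using low[of k x] up[of k x] by (auto simp: abs_le_iff)
    then show "AE x in M. norm (f k x) \<le> max B (A k)" by simp
  qed simp
  have "(\<lambda>k. \<integral>\<^sup>+ x. e2ennreal (ereal (f k x) + ereal B) \<partial>M) \<longlonglongrightarrow>
      (\<integral>\<^sup>+ x. e2ennreal (g x + ereal B) \<partial>M)"
  proof (rule nn_integral_LIMSEQ)
    show "incseq (\<lambda>k x. e2ennreal (ereal (f k x) + ereal B))"
      using inc by (auto simp: incseq_def le_fun_def intro!: ennreal_leI)
    show "(\<lambda>k. e2ennreal (ereal (f k x) + ereal B)) \<longlonglongrightarrow> e2ennreal (g x + ereal B)" for x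
      by (intro tendsto_e2ennrealI tendsto_add_ereal_general lim tendsto_const) auto
  qed auto
  then have "(\<lambda>k. enn2ereal (\<integral>\<^sup>+ x. e2ennreal (ereal (f k x) + ereal B) \<partial>M) - ereal B) \<longlonglongrightarrow>
      enn2ereal (\<integral>\<^sup>+ x. e2ennreal (g x + ereal B) \<partial>M) - ereal B"
    by (intro tendsto_diff_ereal_general tendsto_enn2erealI tendsto_const) auto
  moreover have "enn2ereal (\<integral>\<^sup>+ x. e2ennreal (ereal (f k x) + ereal B) \<partial>M) - ereal B
      = ereal (\<integral>x. f k x \<partial>M)" for k
    by (subst ext_integral_bounded_below[symmetric, OF M])
       (use low B ext_integral_ereal[OF int] in auto)
  ultimately show ?thesis
    by (simp add: ext_integral_bounded_below[OF M _ gB B])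
qed

section \<open>Lower semicontinuous functions\<close>

text \<open>The open sets where g exceeds -n increase to the whole space, so by compactness finitely
  many cover it.\<close>

lemma lower_semicontinuous_bounded_below:
  fixes g :: "'b::metric_space \<Rightarrow> ereal"
  assumes "compact (UNIV :: 'b set)" "lower_semicontinuous g" "\<And>p. g p \<noteq> - \<infinity>"
  obtains B :: real where "0 \<le> B" "\<And>p. ereal (- B) \<le> g p"
proof -
  have cov: "UNIV \<subseteq> (\<Union>n::nat. {p. ereal (- real n) < g p})"
  proof
    fix p
    obtain n :: nat where "ereal (- real n) < g p"
    proof (cases "g p")
      case (real r)
      then show ?thesis using reals_Archimedean2[of "- r"] that by (auto simp: minus_less_iff)
    qed (use assms(3)[of p] that[of 0] in auto)
    then show "p \<in> (\<Union>n::nat. {p. ereal (- real n) < g p})" by auto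
  qed
  have op: "open {p. ereal (- real n) < g p}" for n
    using assms(2) by (simp add: lower_semicontinuous_def)
  obtain N where N: "finite N" "UNIV \<subseteq> (\<Union>n\<in>N. {p. ereal (- real n) < g p})"
    using compactE_image[OF assms(1) op cov] by metis
  show thesis
  proof
    fix p
    obtain n where n: "n \<in> N" "ereal (- real n) < g p" using N(2) by auto
    have "n \<le> Max (insert 0 N)" using N n by simp
    then have "ereal (- real (Max (insert 0 N))) \<le> ereal (- real n)" by simp
    then show "ereal (- real (Max (insert 0 N))) \<le> g p" using n by order
  qed simp
qed

text \<open>The approximations are the Pasch-Hausdorff envelopes (infimal convolutions with a multiple of the
  metric) of the truncations.\<close>

lemma lower_semicontinuous_approx:
  fixes g :: "'b::metric_space \<Rightarrow> ereal"
  assumes lsc: "lower_semicontinuous g" and B: "0 \<le> B" "\<And>p. ereal (- B) \<le> g p"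
  obtains f :: "nat \<Rightarrow> 'b \<Rightarrow> real" where "\<And>k. continuous_on UNIV (f k)"
    "\<And>k p. - B \<le> f k p" "\<And>k p. f k p \<le> real k" "\<And>p. incseq (\<lambda>k. f k p)"
    "\<And>p. (\<lambda>k. ereal (f k p)) \<longlonglongrightarrow> g p"
proof -
  \<comment> \<open>Truncating at k makes the values real, since g is at least -B, and it yields the
    bound by k.\<close>
  define t where "t k q = real_of_ereal (min (g q) (ereal (real k)))" for k q
  have t: "ereal (t k q) = min (g q) (ereal (real k))" for k q
    using B(2)[of q] unfolding t_def by (cases "g q") (auto simp: min_def)
  have tB: "- B \<le> t k q" for k q
    using B(2)[of q] B(1) t[of k q] by (metis ereal_less_eq(3) min.bounded_iff neg_le_0_iff_le of_nat_0_le_iff order_trans)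
  have tk: "t k q \<le> real k" for k q
    using t[of k q] by (metis ereal_less_eq(3) min.cobounded2)
  have tmono: "t k q \<le> t k' q" if "k \<le> k'" for k k' q
    using t[of k q] t[of k' q] that by (metis ereal_less_eq(3) min.mono of_nat_mono order_refl)
  define f where "f k p = (INF q. t k q + real k * dist p q)" for k p
  have nn: "- B \<le> t k q + real k * dist p q" for k p q
    using tB[of k q] by (simp add: add_increasing2)
  have bdd: "bdd_below (range (\<lambda>q. t k q + real k * dist p q))" for k p
    using nn by (intro bdd_belowI2[where m="- B"]) auto
  have flow: "f k p \<le> t k q + real k * dist p q" for k p q
    unfolding f_def by (rule cINF_lower[OF bdd]) simp
  have fB: "- B \<le> f k p" for k p
    unfolding f_def by (rule cINF_greatest) (use nn in auto)
  have ft: "f k p \<le> t k p" for k p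
    using flow[of k p p] by simp
  have lip: "f k p \<le> f k p' + real k * dist p p'" for k p p'
  proof -
    have "f k p - real k * dist p p' \<le> f k p'"
      unfolding f_def[of k p']
    proof (rule cINF_greatest)
      fix q
      have "real k * dist p q \<le> real k * (dist p p' + dist p' q)"
        by (intro mult_left_mono dist_triangle) auto
      then show "f k p - real k * dist p p' \<le> t k q + real k * dist p' q"
        using flow[of k p q] by (simp add: algebra_simps)
    qed simp
    then show ?thesis by simp
  qed
  show thesis
  proof
    show "continuous_on UNIV (f k)" for k
    proof (rule lipschitz_on_continuous_on[of "real k"], rule lipschitz_onI)
      fix p p'
      show "dist (f k p) (f k p') \<le> real k * dist p p'"
        using lip[of k p p'] lip[of k p' p] by (auto simp: dist_real_def dist_commute abs_le_iff)
    qed simp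
    show "- B \<le> f k p" for k p by (rule fB)
    show "f k p \<le> real k" for k p using ft[of k p] tk[of k p] by linarith
    show inc: "incseq (\<lambda>k. f k p)" for p
    proof (rule incseq_SucI)
      fix k
      show "f k p \<le> f (Suc k) p"
        unfolding f_def[of "Suc k"]
      proof (rule cINF_greatest)
        fix q
        have "real k * dist p q \<le> real (Suc k) * dist p q" by (intro mult_right_mono) auto
        then show "f k p \<le> t (Suc k) q + real (Suc k) * dist p q"
          using flow[of k p q] tmono[of k "Suc k" q] by linarith
      qed simp
    qed
    show "(\<lambda>k. ereal (f k p)) \<longlonglongrightarrow> g p" for p
    proof (rule order_tendstoI)
      fix a assume "g p < a"
      have "ereal (f k p) \<le> g p" for k
        using t[of k p] ft[of k p] by (metis ereal_less_eq(3) min.bounded_iff order_trans order_refl)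
      then show "\<forall>\<^sub>F k in sequentially. ereal (f k p) < a"
        using \<open>g p < a\<close> by (intro always_eventually allI) (meson order_le_less_trans)
    next
      fix a assume "a < g p"
      then obtain b where b: "a < ereal b" "ereal b < g p" using ereal_dense2 by blast
      have "open {q. ereal b < g q}" using lsc by (simp add: lower_semicontinuous_def)
      then obtain r where r: "r > 0" "\<And>q. dist q p < r \<Longrightarrow> ereal b < g q"
        using b(2) by (metis (mono_tags) mem_Collect_eq open_dist)
      \<comment> \<open>The first condition keeps the truncation from cutting below b near p; the
        second makes the penalty at distance r or more outweigh the worst value -B.\<close>
      obtain k0 :: nat where k0: "real k0 \<ge> b" "real k0 * r \<ge> b + B"
      proof -
        obtain m :: nat where "real m \<ge> b" using real_arch_simple by blast
        moreover obtain m' :: nat where "real m' \<ge> (b + B) / r" using real_arch_simple by blast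
        ultimately have "real (max m m') \<ge> b" "real (max m m') * r \<ge> b + B"
          using r(1) by (auto simp: field_simps max_def intro: order_trans mult_right_mono)
        then show thesis using that by blast
      qed
      have "b \<le> f k0 p" unfolding f_def
      proof (rule cINF_greatest)
        fix q
        show "b \<le> t k0 q + real k0 * dist p q"
        proof (cases "dist q p < r")
          case True
          then have "ereal b \<le> ereal (t k0 q)" using r(2)[of q] k0(1) unfolding t by auto
          then have "b \<le> t k0 q" by simp
          moreover have "0 \<le> real k0 * dist p q" by simp
          ultimately show ?thesis by linarith
        next
          case False
          then have "real k0 * r \<le> real k0 * dist p q"
            by (intro mult_left_mono) (auto simp: dist_commute)
          then show ?thesis using k0(2) tB[of k0 q] by linarith
        qed
      qed simp
      then have "a < ereal (f k p)" if "k \<ge> k0" for k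
        using b(1) inc[of p] that by (meson ereal_less_eq(3) incseqD order_less_le_trans order_trans)
      then show "\<forall>\<^sub>F k in sequentially. a < ereal (f k p)"
        by (auto simp: eventually_sequentially)
    qed
  qed
qed

section \<open>Compact metric spaces\<close>

lemma compact_finite_net:
  assumes "compact (UNIV :: 'a::metric_space set)" "0 < e"
  obtains F :: "'a::metric_space set" where "finite F" "\<And>x. \<exists>c\<in>F. dist c x < e"
proof -
  have "(UNIV :: 'a set) \<subseteq> (\<Union>c\<in>UNIV. ball c e)" using assms(2) by auto
  then obtain F :: "'a set" where F: "finite F" "UNIV \<subseteq> (\<Union>c\<in>F. ball c e)"
    by (rule compactE_image[OF assms(1) open_ball])
  show thesis
  proof (rule that[OF F(1)])
    fix x
    have "x \<in> (\<Union>c\<in>F. ball c e)" using F(2) by blast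
    then show "\<exists>c\<in>F. dist c x < e" by auto
  qed
qed

text \<open>The type is merely a metric space, so second countability has to come from compactness:
  balls of radius 1/(n+1) about finite nets.\<close>

lemma compact_countable_basis:
  assumes "compact (UNIV :: 'a::metric_space set)"
  obtains \<B> :: "'a::metric_space set set" where "countable \<B>" "topological_basis \<B>"
proof -
  have "\<exists>F :: 'a set. finite F \<and> (\<forall>x. \<exists>c\<in>F. dist c x < inverse (real (Suc n)))" for n
    by (rule compact_finite_net[OF assms, of "inverse (real (Suc n))"]) auto
  then obtain F where F: "\<And>n. finite (F n)" "\<And>n x::'a. \<exists>c\<in>F n. dist c x < inverse (real (Suc n))"
    by metis
  let ?B = "\<Union>n. (\<lambda>c. ball c (inverse (real (Suc n)))) ` F n"
  show thesis
  proof
    show "countable ?B" using F(1) by (auto intro: countable_finite)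
    show "topological_basis ?B"
    proof (rule topological_basisI)
      show "open b" if "b \<in> ?B" for b using that by auto
      fix U :: "'a set" and x assume "open U" "x \<in> U"
      then obtain e where e: "e > 0" "ball x e \<subseteq> U" by (meson openE)
      \<comment> \<open>Half of e, because x lies within 1/(n+1) of the centre and the other points
        of the ball lie within another 1/(n+1).\<close>
      obtain n where n: "inverse (real (Suc n)) < e / 2"
        using reals_Archimedean[of "e / 2"] e(1) by auto
      obtain c where c: "c \<in> F n" "dist c x < inverse (real (Suc n))" using F(2) by blast
      have "ball c (inverse (real (Suc n))) \<subseteq> ball x e"
      proof
        fix y assume "y \<in> ball c (inverse (real (Suc n)))"
        then have "dist x y < inverse (real (Suc n)) + inverse (real (Suc n))"
          using dist_triangle[of x y c] c(2) by (simp add: dist_commute)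
        then show "y \<in> ball x e" using n by simp
      qed
      then show "\<exists>B'\<in>?B. x \<in> B' \<and> B' \<subseteq> U" using c e(2) by auto
    qed
  qed
qed

text \<open>In general an open subset of a product need not belong to the product sigma-algebra. A
  countable basis writes it as a countable union of open rectangles.\<close>

lemma open_sets_pair_borel:
  assumes "compact (UNIV :: 'a::metric_space set)" "open (U :: ('a::metric_space \<times> 'a) set)"
  shows "U \<in> sets (borel \<Otimes>\<^sub>M borel)"
proof -
  obtain \<B> :: "'a set set" where \<B>: "countable \<B>" "topological_basis \<B>"
    using compact_countable_basis[OF assms(1)] by blast
  let ?R = "(\<lambda>(a, b). a \<times> b) ` (\<B> \<times> \<B>)"
  have "topological_basis ?R" by (intro topological_basis_prod \<B>)
  then obtain R where R: "R \<subseteq> ?R" "\<Union>R = U"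
    using assms(2) unfolding topological_basis_def by meson
  have "countable R" using R(1) \<B>(1) by (meson countable_SIGMA countable_image countable_subset)
  moreover have "r \<in> sets (borel \<Otimes>\<^sub>M borel)" if "r \<in> R" for r
    using that R(1) topological_basis_open[OF \<B>(2)] by auto
  ultimately show ?thesis using R(2) by (metis sets.countable_Union subsetI)
qed

lemma continuous_measurable_pair_borel:
  fixes f :: "'a::metric_space \<times> 'a \<Rightarrow> real"
  assumes "compact (UNIV :: 'a set)" "continuous_on UNIV f"
  shows "f \<in> borel_measurable (borel \<Otimes>\<^sub>M borel)"
proof (rule borel_measurableI)
  fix S :: "real set" assume "open S"
  then have "open (f -` S)" using assms(2) by (simp add: continuous_on_open_vimage)
  then show "f -` S \<inter> space (borel \<Otimes>\<^sub>M borel) \<in> sets (borel \<Otimes>\<^sub>M borel)"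
    using open_sets_pair_borel[OF assms(1)] by (simp add: space_pair_measure)
qed

lemma closed_measure_support: "closed (measure_support \<nu>)"
proof -
  have "- measure_support \<nu> = \<Union>{U. open U \<and> emeasure \<nu> U = 0}"
    by (auto simp: measure_support_def zero_less_iff_neq_zero)
  then have "open (- measure_support \<nu>)" by auto
  then show ?thesis by (simp add: closed_def)
qed

text \<open>Points outside the support have open null neighbourhoods. Shrinking these to basic sets
  leaves a countable union of null sets.\<close>

lemma AE_measure_support:
  fixes \<nu> :: "'a::metric_space measure"
  assumes "compact (UNIV :: 'a set)" "sets \<nu> = sets borel"
  shows "AE x in \<nu>. x \<in> measure_support \<nu>"
proof -
  obtain \<B> :: "'a set set" where \<B>: "countable \<B>" "topological_basis \<B>"
    using compact_countable_basis[OF assms(1)] by blast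
  let ?N = "\<Union>{b \<in> \<B>. emeasure \<nu> b = 0}"
  have "?N \<in> null_sets \<nu>"
    by (intro null_sets_UN'[of _ "\<lambda>b. b", simplified])
       (use \<B>(1) topological_basis_open[OF \<B>(2)] in \<open>auto simp: assms(2) null_sets_def\<close>)
  moreover have "{x \<in> space \<nu>. x \<notin> measure_support \<nu>} \<subseteq> ?N"
  proof
    fix x assume "x \<in> {x \<in> space \<nu>. x \<notin> measure_support \<nu>}"
    then obtain U where U: "open U" "x \<in> U" "emeasure \<nu> U = 0"
      by (auto simp: measure_support_def zero_less_iff_neq_zero)
    obtain b where b: "b \<in> \<B>" "x \<in> b" "b \<subseteq> U"
      using topological_basisE[OF \<B>(2) U(1,2)] by blast
    have "emeasure \<nu> b \<le> emeasure \<nu> U"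
      by (rule emeasure_mono) (use b U assms(2) in auto)
    then show "x \<in> ?N" using b U(3) by auto
  qed
  ultimately show ?thesis by (rule AE_I')
qed

section \<open>The weak topology\<close>

lemma prob_measuresD:
  assumes "\<mu> \<in> prob_measures"
  shows "prob_space \<mu>" "sets \<mu> = sets borel" "space \<mu> = UNIV"
  using assms sets_eq_imp_space_eq[of \<mu> borel] by (auto simp: prob_measures_def)

lemma topspace_weak_topology: "topspace weak_topology = prob_measures"
  unfolding weak_topology_def topology_generated_by_topspace
proof (intro equalityI subsetI)
  fix \<mu> :: "'a measure" assume "\<mu> \<in> prob_measures"
  \<comment> \<open>The constant 0 together with the whole line makes \<open>prob_measures\<close>
    itself a subbasic set.\<close>
  moreover have "\<exists>(f :: 'a \<Rightarrow> real) U. prob_measures = {\<mu> \<in> prob_measures. (\<integral>x. f x \<partial>\<mu>) \<in> U} \<and>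
      continuous_on UNIV f \<and> bounded (range f) \<and> open U"
    by (intro exI[of _ "\<lambda>_. 0"] exI[of _ UNIV]) auto
  ultimately show "\<mu> \<in> \<Union>{{\<mu> \<in> prob_measures. (\<integral>x. f x \<partial>\<mu>) \<in> U} | (f :: 'a \<Rightarrow> real) U.
        continuous_on UNIV f \<and> bounded (range f) \<and> open U}"
    by (intro UnionI[of prob_measures] CollectI)
qed auto

lemma bounded_range_compact:
  fixes f :: "'a::metric_space \<Rightarrow> real"
  assumes "compact (UNIV :: 'a set)" "continuous_on UNIV f"
  shows "bounded (range f)"
  using compact_continuous_image[OF assms(2,1)] compact_imp_bounded by blast

lemma continuous_map_weak_integral:
  fixes f :: "'a::metric_space \<Rightarrow> real"
  assumes "compact (UNIV :: 'a set)" "continuous_on UNIV f"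
  shows "continuous_map weak_topology euclideanreal (\<lambda>\<mu>. \<integral>x. f x \<partial>\<mu>)"
  unfolding continuous_map_def topspace_weak_topology
proof (intro conjI allI impI)
  fix U :: "real set" assume "openin euclideanreal U"
  then show "openin weak_topology {\<mu> \<in> prob_measures. (\<integral>x. f x \<partial>\<mu>) \<in> U}"
    unfolding weak_topology_def
    by (intro topology_generated_by_Basis CollectI exI[of _ f] exI[of _ U])
       (use assms bounded_range_compact[OF assms] in auto)
qed auto

lemma integrable_prob_measures:
  fixes f :: "'a::metric_space \<Rightarrow> real"
  assumes "compact (UNIV :: 'a set)" "continuous_on UNIV f" "\<mu> \<in> prob_measures"
  shows "integrable \<mu> f"
proof -
  interpret prob_space \<mu> by (rule prob_measuresD[OF assms(3)])
  obtain b where "\<And>x. norm (f x) \<le> b"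
    using bounded_range_compact[OF assms(1,2)] by (auto simp: bounded_iff)
  moreover have "f \<in> borel_measurable \<mu>"
    using borel_measurable_continuous_onI[OF assms(2)] prob_measuresD(2)[OF assms(3)]
    by (simp cong: measurable_cong_sets)
  ultimately show ?thesis by (intro integrable_const_bound[where B=b]) auto
qed

text \<open>The weak topology comes without a metric; this allows epsilon estimates on
  neighbourhoods to prove continuity.\<close>

lemma continuous_map_euclideanreal_nhds:
  assumes "\<And>x e. x \<in> topspace X \<Longrightarrow> 0 < e \<Longrightarrow>
    \<exists>U. openin X U \<and> x \<in> U \<and> (\<forall>y\<in>U. \<bar>h y - h x\<bar> < e)"
  shows "continuous_map X euclideanreal h"
  unfolding continuous_map_def
proof (intro conjI allI impI)
  fix V :: "real set" assume "openin euclideanreal V"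
  then have V: "open V" by simp
  show "openin X {x \<in> topspace X. h x \<in> V}"
  proof (subst openin_subopen, intro ballI)
    fix x assume x: "x \<in> {x \<in> topspace X. h x \<in> V}"
    then have "h x \<in> V" by simp
    then obtain e where "e > 0" and b: "ball (h x) e \<subseteq> V" using V openE by blast
    have e: "t \<in> V" if "\<bar>t - h x\<bar> < e" for t
      using b that by (auto simp: dist_real_def abs_minus_commute)
    obtain U where "openin X U" "x \<in> U" "\<forall>y\<in>U. \<bar>h y - h x\<bar> < e"
      using assms[of x e] x \<open>e > 0\<close> by auto
    then show "\<exists>T. openin X T \<and> x \<in> T \<and> T \<subseteq> {x \<in> topspace X. h x \<in> V}"
      using e openin_subset by (intro exI[of _ U]) blast
  qed
qed auto

section \<open>Potentials of continuous kernels\<close>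

locale continuous_kernel =
  fixes f :: "'a::metric_space \<Rightarrow> 'a \<Rightarrow> real"
  assumes compact: "compact (UNIV :: 'a set)"
    and continuous: "continuous_on UNIV (\<lambda>(x, y). f x y)"
begin

lemma continuous_section: "continuous_on UNIV (f x)"
proof -
  have "continuous_on UNIV (\<lambda>y. (x, y))"
    by (intro continuous_on_Pair continuous_on_const continuous_on_id)
  from continuous_on_compose2[OF continuous this] show ?thesis by simp
qed

lemma bound: obtains b where "0 \<le> b" "\<And>x y. \<bar>f x y\<bar> \<le> b"
proof -
  have "bounded (range (\<lambda>(x, y). f x y))"
    by (rule bounded_range_compact[OF _ continuous])
       (use compact_Times[OF compact compact] in simp)
  then obtain b where "\<And>p. \<bar>case p of (x, y) \<Rightarrow> f x y\<bar> \<le> b" by (auto simp: bounded_iff)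
  then have "\<bar>f x y\<bar> \<le> b" for x y by (metis case_prod_conv)
  then show thesis using that[of b] by (metis abs_ge_zero order_trans)
qed

lemma uniform:
  assumes "0 < e"
  obtains d where "0 < d" "\<And>x x' y. dist x x' < d \<Longrightarrow> \<bar>f x y - f x' y\<bar> < e"
proof -
  have "uniformly_continuous_on UNIV (\<lambda>(x, y). f x y)"
    by (rule compact_uniformly_continuous[OF continuous])
       (use compact_Times[OF compact compact] in simp)
  then obtain d where d: "d > 0"
      "\<And>p p'. dist p' p < d \<Longrightarrow> \<bar>(case p' of (x, y) \<Rightarrow> f x y) - (case p of (x, y) \<Rightarrow> f x y)\<bar> < e"
    using assms unfolding uniformly_continuous_on_def dist_real_def by (metis UNIV_I)
  have "\<bar>f x y - f x' y\<bar> < e" if "dist x x' < d" for x x' y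
    using d(2)[of "(x, y)" "(x', y)"] that by (simp add: dist_Pair_Pair)
  with d(1) show thesis by (rule that)
qed

lemma integrable_section: "\<mu> \<in> prob_measures \<Longrightarrow> integrable \<mu> (f x)"
  by (rule integrable_prob_measures[OF compact continuous_section])

lemma integral_diff_le:
  assumes "\<mu> \<in> prob_measures" "\<And>y. \<bar>f x y - f x' y\<bar> \<le> e"
  shows "\<bar>(\<integral>y. f x y \<partial>\<mu>) - (\<integral>y. f x' y \<partial>\<mu>)\<bar> \<le> e"
proof -
  interpret prob_space \<mu> by (rule prob_measuresD[OF assms(1)])
  have "\<bar>(\<integral>y. f x y \<partial>\<mu>) - (\<integral>y. f x' y \<partial>\<mu>)\<bar> = \<bar>\<integral>y. f x y - f x' y \<partial>\<mu>\<bar>"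
    using integrable_section[OF assms(1)] by simp
  also have "\<dots> \<le> (\<integral>y. \<bar>f x y - f x' y\<bar> \<partial>\<mu>)" by (rule integral_abs_bound)
  also have "\<dots> \<le> (\<integral>y. e \<partial>\<mu>)"
    by (intro integral_mono) (use integrable_section[OF assms(1)] assms(2) in auto)
  finally show ?thesis by (simp add: prob_space)
qed

lemma continuous_integral:
  assumes "\<mu> \<in> prob_measures"
  shows "continuous_on UNIV (\<lambda>x. \<integral>y. f x y \<partial>\<mu>)"
  unfolding continuous_on_iff
proof (intro ballI allI impI)
  fix x :: 'a and e :: real assume "0 < e"
  then obtain d where "0 < d" "\<And>x x' y. dist x x' < d \<Longrightarrow> \<bar>f x y - f x' y\<bar> < e / 2"
    using uniform[of "e / 2"] by auto
  then have le: "\<bar>(\<integral>y. f x' y \<partial>\<mu>) - (\<integral>y. f x y \<partial>\<mu>)\<bar> \<le> e / 2" if "dist x' x < d" for x'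
    using that by (intro integral_diff_le[OF assms] less_imp_le) auto
  have "dist (\<integral>y. f x' y \<partial>\<mu>) (\<integral>y. f x y \<partial>\<mu>) < e" if "dist x' x < d" for x'
    using le[OF that] \<open>0 < e\<close> by (simp add: dist_real_def)
  then show "\<exists>d>0. \<forall>x'\<in>UNIV. dist x' x < d \<longrightarrow> dist (\<integral>y. f x' y \<partial>\<mu>) (\<integral>y. f x y \<partial>\<mu>) < e"
    using \<open>0 < d\<close> by blast
qed

text \<open>The sections \<open>f x\<close> vary uniformly continuously with x, so each potential
  differs by at most e/2, for either measure, from its value at a point of a finite net. The net
  depends on neither measure, so finitely many integrals control the potentials at all points at
  once.\<close>

lemma finite_test_family:
  assumes "0 < e"
  obtains F where "finite F" "\<And>\<mu> \<mu>' x. \<mu> \<in> prob_measures \<Longrightarrow> \<mu>' \<in> prob_measures \<Longrightarrow>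
    \<bar>(\<integral>y. f x y \<partial>\<mu>) - (\<integral>y. f x y \<partial>\<mu>')\<bar> \<le>
      e + (\<Sum>c\<in>F. \<bar>(\<integral>y. f c y \<partial>\<mu>) - (\<integral>y. f c y \<partial>\<mu>')\<bar>)"
proof -
  obtain d where d: "0 < d" "\<And>x x' y. dist x x' < d \<Longrightarrow> \<bar>f x y - f x' y\<bar> < e / 2"
    using uniform[of "e / 2"] assms by auto
  obtain F :: "'a set" where F: "finite F" "\<And>x. \<exists>c\<in>F. dist c x < d"
    using compact_finite_net[OF compact d(1)] by blast
  show thesis
  proof (rule that[OF F(1)])
    fix \<mu> \<mu>' :: "'a measure" and x
    assume \<mu>: "\<mu> \<in> prob_measures" "\<mu>' \<in> prob_measures"
    obtain c where c: "c \<in> F" "dist c x < d" using F(2) by blast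
    have "\<bar>(\<integral>y. f c y \<partial>\<mu>) - (\<integral>y. f x y \<partial>\<mu>)\<bar> \<le> e / 2" "\<bar>(\<integral>y. f c y \<partial>\<mu>') - (\<integral>y. f x y \<partial>\<mu>')\<bar> \<le> e / 2"
      using integral_diff_le[OF \<mu>(1), of c x "e / 2"] integral_diff_le[OF \<mu>(2), of c x "e / 2"] d(2)[OF c(2)]
      by (auto simp: less_imp_le)
    moreover have "\<bar>(\<integral>y. f c y \<partial>\<mu>) - (\<integral>y. f c y \<partial>\<mu>')\<bar> \<le>
        (\<Sum>c\<in>F. \<bar>(\<integral>y. f c y \<partial>\<mu>) - (\<integral>y. f c y \<partial>\<mu>')\<bar>)"
      using c(1) F(1) by (intro member_le_sum) auto
    ultimately show "\<bar>(\<integral>y. f x y \<partial>\<mu>) - (\<integral>y. f x y \<partial>\<mu>')\<bar> \<le>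
      e + (\<Sum>c\<in>F. \<bar>(\<integral>y. f c y \<partial>\<mu>) - (\<integral>y. f c y \<partial>\<mu>')\<bar>)" by linarith
  qed
qed

lemma weak_neighbourhood:
  assumes "finite F" "\<mu> \<in> prob_measures" "0 < e"
  shows "openin weak_topology
      {\<mu>' \<in> prob_measures. (\<Sum>c\<in>F. \<bar>(\<integral>y. f c y \<partial>\<mu>) - (\<integral>y. f c y \<partial>\<mu>')\<bar>) < e}"
proof -
  have "continuous_map weak_topology euclideanreal
      (\<lambda>\<mu>'. \<Sum>c\<in>F. \<bar>(\<integral>y. f c y \<partial>\<mu>) - (\<integral>y. f c y \<partial>\<mu>')\<bar>)"
    by (intro continuous_map_sum continuous_map_real_abs continuous_map_diff
        continuous_map_weak_integral compact continuous_section assms) auto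
  from openin_continuous_map_preimage[OF this, of "{..<e}"]
  show ?thesis by (simp add: topspace_weak_topology)
qed

lemma borel_measurable_kernel: "(\<lambda>(x, y). f x y) \<in> borel_measurable (borel \<Otimes>\<^sub>M borel)"
  by (rule continuous_measurable_pair_borel[OF compact continuous])

lemma integrable_pair:
  assumes "\<mu> \<in> prob_measures" "\<mu>' \<in> prob_measures"
  shows "integrable (\<mu> \<Otimes>\<^sub>M \<mu>') (\<lambda>(x, y). f x y)"
proof -
  interpret P: prob_space \<mu> by (rule prob_measuresD[OF assms(1)])
  interpret Q: prob_space \<mu>' by (rule prob_measuresD[OF assms(2)])
  interpret PQ: pair_prob_space \<mu> \<mu>' ..
  obtain b where "\<And>x y. \<bar>f x y\<bar> \<le> b" using bound by blast
  moreover have "(\<lambda>(x, y). f x y) \<in> borel_measurable (\<mu> \<Otimes>\<^sub>M \<mu>')"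
    using borel_measurable_kernel prob_measuresD(2)[OF assms(1)] prob_measuresD(2)[OF assms(2)]
    by (simp cong: measurable_cong_sets sets_pair_measure_cong)
  ultimately show ?thesis by (intro PQ.P.integrable_const_bound[where B=b]) auto
qed

lemma Fubini:
  assumes "\<mu> \<in> prob_measures" "\<mu>' \<in> prob_measures"
  shows "(\<integral>x. (\<integral>y. f x y \<partial>\<mu>') \<partial>\<mu>) = (\<integral>y. (\<integral>x. f x y \<partial>\<mu>) \<partial>\<mu>')"
    and "(\<integral>x. (\<integral>y. f x y \<partial>\<mu>') \<partial>\<mu>) = (\<integral>p. (case p of (x, y) \<Rightarrow> f x y) \<partial>(\<mu> \<Otimes>\<^sub>M \<mu>'))"
proof -
  interpret P: prob_space \<mu> by (rule prob_measuresD[OF assms(1)])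
  interpret Q: prob_space \<mu>' by (rule prob_measuresD[OF assms(2)])
  interpret PQ: pair_prob_space \<mu> \<mu>' ..
  show "(\<integral>x. (\<integral>y. f x y \<partial>\<mu>') \<partial>\<mu>) = (\<integral>y. (\<integral>x. f x y \<partial>\<mu>) \<partial>\<mu>')"
    using PQ.Fubini_integral[OF integrable_pair[OF assms]] by simp
  show "(\<integral>x. (\<integral>y. f x y \<partial>\<mu>') \<partial>\<mu>) = (\<integral>p. (case p of (x, y) \<Rightarrow> f x y) \<partial>(\<mu> \<Otimes>\<^sub>M \<mu>'))"
    using PQ.integral_fst'[OF integrable_pair[OF assms]] by simp
qed

text \<open>The functional is quadratic, so the two copies of the measure are exchanged one at a
  time. By symmetry both exchanges pass through the same mixed term, and each is the integral of a
  uniformly small difference of potentials.\<close>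

lemma continuous_map_energy:
  assumes sym: "\<And>x y. f x y = f y x"
  shows "continuous_map weak_topology euclideanreal (\<lambda>\<mu>. \<integral>x. (\<integral>y. f x y \<partial>\<mu>) \<partial>\<mu>)"
proof (rule continuous_map_euclideanreal_nhds)
  fix \<mu> :: "'a measure" and e :: real
  assume "\<mu> \<in> topspace weak_topology" "0 < e"
  then have \<mu>: "\<mu> \<in> prob_measures" by (simp add: topspace_weak_topology)
  \<comment> \<open>The net error e/5 and the neighbourhood bound e/5 give 2e/5 per exchange, hence
    4e/5 < e for the two.\<close>
  obtain F where F: "finite F" "\<And>\<mu> \<mu>' x. \<mu> \<in> prob_measures \<Longrightarrow> \<mu>' \<in> prob_measures \<Longrightarrow>
    \<bar>(\<integral>y. f x y \<partial>\<mu>) - (\<integral>y. f x y \<partial>\<mu>')\<bar> \<le>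
      e / 5 + (\<Sum>c\<in>F. \<bar>(\<integral>y. f c y \<partial>\<mu>) - (\<integral>y. f c y \<partial>\<mu>')\<bar>)"
    using finite_test_family[of "e / 5"] \<open>0 < e\<close> by auto
  let ?U = "{\<mu>' \<in> prob_measures. (\<Sum>c\<in>F. \<bar>(\<integral>y. f c y \<partial>\<mu>) - (\<integral>y. f c y \<partial>\<mu>')\<bar>) < e / 5}"
  show "\<exists>U. openin weak_topology U \<and> \<mu> \<in> U \<and>
      (\<forall>\<mu>'\<in>U. \<bar>(\<integral>x. (\<integral>y. f x y \<partial>\<mu>') \<partial>\<mu>') - (\<integral>x. (\<integral>y. f x y \<partial>\<mu>) \<partial>\<mu>)\<bar> < e)"
  proof (intro exI[of _ ?U] conjI ballI)
    show "openin weak_topology ?U" by (rule weak_neighbourhood[OF F(1) \<mu>]) (use \<open>0 < e\<close> in simp)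
    show "\<mu> \<in> ?U" using \<mu> \<open>0 < e\<close> by simp
    fix \<mu>' assume "\<mu>' \<in> ?U"
    then have \<mu>': "\<mu>' \<in> prob_measures"
      and *: "(\<Sum>c\<in>F. \<bar>(\<integral>y. f c y \<partial>\<mu>) - (\<integral>y. f c y \<partial>\<mu>')\<bar>) < e / 5" by auto
    have d: "\<bar>(\<integral>y. f x y \<partial>\<mu>) - (\<integral>y. f x y \<partial>\<mu>')\<bar> \<le> 2 * e / 5" for x
      using F(2)[OF \<mu> \<mu>', of x] * by linarith
    have int: "integrable \<rho> (\<lambda>x. \<integral>y. f x y \<partial>\<rho>')"
      if "\<rho> \<in> prob_measures" "\<rho>' \<in> prob_measures" for \<rho> \<rho>'
      by (rule integrable_prob_measures[OF compact continuous_integral]) (use that in auto)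
    have D: "\<bar>(\<integral>x. (\<integral>y. f x y \<partial>\<mu>) \<partial>\<rho>) - (\<integral>x. (\<integral>y. f x y \<partial>\<mu>') \<partial>\<rho>)\<bar> \<le> 2 * e / 5"
      if \<rho>: "\<rho> \<in> prob_measures" for \<rho>
    proof -
      interpret prob_space \<rho> by (rule prob_measuresD[OF \<rho>])
      have "\<bar>(\<integral>x. (\<integral>y. f x y \<partial>\<mu>) \<partial>\<rho>) - (\<integral>x. (\<integral>y. f x y \<partial>\<mu>') \<partial>\<rho>)\<bar> =
          \<bar>\<integral>x. (\<integral>y. f x y \<partial>\<mu>) - (\<integral>y. f x y \<partial>\<mu>') \<partial>\<rho>\<bar>"
        using int[OF \<rho> \<mu>] int[OF \<rho> \<mu>'] by simp
      also have "\<dots> \<le> (\<integral>x. \<bar>(\<integral>y. f x y \<partial>\<mu>) - (\<integral>y. f x y \<partial>\<mu>')\<bar> \<partial>\<rho>)"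
        by (rule integral_abs_bound)
      also have "\<dots> \<le> (\<integral>x. 2 * e / 5 \<partial>\<rho>)"
        by (intro integral_mono) (use d int[OF \<rho> \<mu>] int[OF \<rho> \<mu>'] in auto)
      finally show ?thesis by (simp add: prob_space)
    qed
    have "(\<integral>x. (\<integral>y. f x y \<partial>\<mu>) \<partial>\<mu>') = (\<integral>y. (\<integral>x. f x y \<partial>\<mu>') \<partial>\<mu>)"
      by (rule Fubini(1)[OF \<mu>' \<mu>])
    also have "\<dots> = (\<integral>x. (\<integral>y. f x y \<partial>\<mu>') \<partial>\<mu>)" using sym by simp
    finally show "\<bar>(\<integral>x. (\<integral>y. f x y \<partial>\<mu>') \<partial>\<mu>') - (\<integral>x. (\<integral>y. f x y \<partial>\<mu>) \<partial>\<mu>)\<bar> < e"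
      using D[OF \<mu>] D[OF \<mu>'] \<open>0 < e\<close> by linarith
  qed
qed

end

section \<open>Empirical measures and product measures\<close>

lemma empirical_measure_prob:
  assumes "0 < n"
  shows "empirical_measure n x \<in> prob_measures"
proof -
  have "prob_space (uniform_count_measure {..<n})"
    by (rule prob_space_uniform_count_measure) (use assms in auto)
  moreover have "x \<in> measurable (uniform_count_measure {..<n}) borel"
    by (auto simp: measurable_def sets_uniform_count_measure space_uniform_count_measure)
  ultimately show ?thesis
    unfolding prob_measures_def empirical_measure_def by (auto intro: prob_space.prob_space_distr)
qed

lemma integral_empirical_measure:
  fixes f :: "'a::topological_space \<Rightarrow> real"
  assumes "f \<in> borel_measurable borel"
  shows "(\<integral>y. f y \<partial>(empirical_measure n x)) = (\<Sum>i<n. f (x i)) / real n"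
proof -
  have "x \<in> measurable (uniform_count_measure {..<n}) borel"
    by (auto simp: measurable_def sets_uniform_count_measure space_uniform_count_measure)
  then show ?thesis
    unfolding empirical_measure_def
    by (subst integral_distr) (use assms in \<open>auto simp: integral_uniform_count_measure\<close>)
qed

text \<open>Checked on rectangles, whose preimages are cylinders over the two coordinates; as i and
  j differ, the cylinder measure has two separate factors.\<close>

lemma distr_PiM_two_components:
  assumes M: "prob_space M" and ij: "i \<in> I" "j \<in> I" "i \<noteq> j"
  shows "distr (PiM I (\<lambda>_. M)) (M \<Otimes>\<^sub>M M) (\<lambda>z. (z i, z j)) = M \<Otimes>\<^sub>M M"
proof (rule pair_measure_eqI[symmetric])
  interpret prob_space M by fact
  show "sigma_finite_measure M" "sigma_finite_measure M" by unfold_locales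
  fix A B assume AB: "A \<in> sets M" "B \<in> sets M"
  have [measurable]: "(\<lambda>z. (z i, z j)) \<in> measurable (PiM I (\<lambda>_. M)) (M \<Otimes>\<^sub>M M)"
    using ij by measurable
  have "(\<lambda>z. (z i, z j)) -` (A \<times> B) \<inter> space (PiM I (\<lambda>_. M)) =
      prod_emb I (\<lambda>_. M) {i, j} (\<Pi>\<^sub>E k\<in>{i, j}. if k = i then A else B)"
    using ij by (auto simp: prod_emb_def space_PiM PiE_iff split: if_splits)
  moreover have "emeasure (PiM I (\<lambda>_. M))
      (prod_emb I (\<lambda>_. M) {i, j} (\<Pi>\<^sub>E k\<in>{i, j}. if k = i then A else B)) =
      (\<Prod>k\<in>{i, j}. emeasure M (if k = i then A else B))"
    by (rule emeasure_PiM_emb) (use ij AB M in auto)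
  ultimately show "emeasure M A * emeasure M B =
      emeasure (distr (PiM I (\<lambda>_. M)) (M \<Otimes>\<^sub>M M) (\<lambda>z. (z i, z j))) (A \<times> B)"
    using AB ij by (simp add: emeasure_distr)
qed simp

text \<open>The centred variables are bounded by 2b and pairwise uncorrelated, so only the n
  diagonal terms contribute to the second moment of their sum, each at most 4b^2.\<close>

lemma (in prob_space) integral_average_deviation_le:
  fixes h :: "'a \<Rightarrow> real"
  assumes h[measurable]: "h \<in> borel_measurable M" and b: "\<And>x. \<bar>h x\<bar> \<le> b" and n: "0 < n"
  shows "(\<integral>z. \<bar>(\<Sum>i<n. h (z i)) / real n - (\<integral>x. h x \<partial>M)\<bar> \<partial>(PiM {..<n} (\<lambda>_. M))) \<le> 2 * b / sqrt (real n)"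
proof -
  let ?P = "PiM {..<n} (\<lambda>_. M)"
  interpret P: prob_space ?P by (intro prob_space_PiM prob_space_axioms)
  interpret MM: pair_prob_space M M ..
  define m where "m = (\<integral>x. h x \<partial>M)"
  have b0: "0 \<le> b" using b[of undefined] by linarith
  have ih: "integrable M h" by (rule integrable_const_bound[where B=b]) (use b in auto)
  have "\<bar>m\<bar> \<le> (\<integral>x. \<bar>h x\<bar> \<partial>M)" unfolding m_def by (rule integral_abs_bound)
  also have "\<dots> \<le> (\<integral>x. b \<partial>M)" by (intro integral_mono) (use b ih in auto)
  finally have m: "\<bar>m\<bar> \<le> b" by (simp add: prob_space)
  define X where "X x = h x - m" for x
  have [measurable]: "X \<in> borel_measurable M" unfolding X_def by measurable
  have Xb: "\<bar>X x\<bar> \<le> 2 * b" for x using b[of x] m unfolding X_def by linarith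
  have iX: "integrable M X" unfolding X_def using ih by simp
  have X0: "(\<integral>x. X x \<partial>M) = 0" unfolding X_def using ih by (simp add: m_def prob_space)
  have prodb: "\<bar>X x * X y\<bar> \<le> 4 * b\<^sup>2" for x y
  proof -
    have "\<bar>X x\<bar> * \<bar>X y\<bar> \<le> (2 * b) * (2 * b)" by (intro mult_mono Xb) (use b0 in auto)
    then show ?thesis by (simp add: abs_mult power2_eq_square)
  qed
  have iXX: "integrable ?P (\<lambda>z. X (z i) * X (z j))" if "i < n" "j < n" for i j
    by (rule P.integrable_const_bound[where B="4 * b\<^sup>2"]) (use that prodb in auto)
  have cov: "(\<integral>z. X (z i) * X (z j) \<partial>?P) \<le> (if i = j then 4 * b\<^sup>2 else 0)" if ij: "i < n" "j < n" for i j
  proof (cases "i = j")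
    case True
    have "(\<integral>z. X (z i) * X (z j) \<partial>?P) \<le> (\<integral>z. 4 * b\<^sup>2 \<partial>?P)"
      by (intro integral_mono iXX ij) (use prodb abs_le_D1 in auto)
    then show ?thesis using True by (simp add: P.prob_space)
  next
    case False
    have "(\<integral>z. X (z i) * X (z j) \<partial>?P) =
        (\<integral>p. X (fst p) * X (snd p) \<partial>(distr ?P (M \<Otimes>\<^sub>M M) (\<lambda>z. (z i, z j))))"
      using ij by (subst integral_distr) auto
    also have "\<dots> = (\<integral>p. X (fst p) * X (snd p) \<partial>(M \<Otimes>\<^sub>M M))"
      using ij False by (subst distr_PiM_two_components[OF prob_space_axioms]) auto
    also have "\<dots> = (\<integral>x. (\<integral>y. X x * X y \<partial>M) \<partial>M)"
      by (subst MM.integral_fst'[symmetric])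
         (auto intro!: MM.P.integrable_const_bound[where B="4 * b\<^sup>2"] prodb)
    also have "\<dots> = 0" by (simp add: X0)
    finally show ?thesis using False by simp
  qed
  define S where "S z = (\<Sum>i<n. X (z i))" for z :: "nat \<Rightarrow> 'a"
  have S2: "(S z)\<^sup>2 = (\<Sum>i<n. \<Sum>j<n. X (z i) * X (z j))" for z
    unfolding S_def power2_eq_square by (rule sum_product)
  have [measurable]: "S \<in> borel_measurable ?P" unfolding S_def by measurable
  have Sb: "\<bar>S z\<bar> \<le> real n * (2 * b)" for z
  proof -
    have "\<bar>S z\<bar> \<le> (\<Sum>i<n. \<bar>X (z i)\<bar>)" unfolding S_def by (rule sum_abs)
    also have "\<dots> \<le> (\<Sum>i<n. 2 * b)" by (intro sum_mono Xb)
    finally show ?thesis by simp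
  qed
  have iS: "integrable ?P (\<lambda>z. \<bar>S z\<bar>)"
    by (rule P.integrable_const_bound[where B="real n * (2 * b)"]) (use Sb in auto)
  have iS2: "integrable ?P (\<lambda>z. (S z)\<^sup>2)" unfolding S2 by (intro Bochner_Integration.integrable_sum iXX) auto
  have "(\<integral>z. (S z)\<^sup>2 \<partial>?P) = (\<Sum>i<n. \<Sum>j<n. \<integral>z. X (z i) * X (z j) \<partial>?P)"
    unfolding S2
    by (subst Bochner_Integration.integral_sum, (intro Bochner_Integration.integrable_sum iXX; simp),
        intro sum.cong refl Bochner_Integration.integral_sum iXX) auto
  also have "\<dots> \<le> (\<Sum>i<n. \<Sum>j<n. if i = j then 4 * b\<^sup>2 else 0)"
    by (intro sum_mono cov) auto
  also have "\<dots> = real n * (4 * b\<^sup>2)" by simp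
  finally have second: "(\<integral>z. (S z)\<^sup>2 \<partial>?P) \<le> real n * (4 * b\<^sup>2)" .
  \<comment> \<open>Nonnegative variance of the absolute value is the Cauchy-Schwarz bound of the
    first moment by the second.\<close>
  have "0 \<le> P.variance (\<lambda>z. \<bar>S z\<bar>)" by (rule P.variance_positive)
  also have "\<dots> = (\<integral>z. (S z)\<^sup>2 \<partial>?P) - (\<integral>z. \<bar>S z\<bar> \<partial>?P)\<^sup>2"
    by (subst P.variance_eq) (use iS iS2 in auto)
  finally have "(\<integral>z. \<bar>S z\<bar> \<partial>?P)\<^sup>2 \<le> (2 * b * sqrt (real n))\<^sup>2"
    using second by (simp add: power_mult_distrib algebra_simps)
  then have first: "(\<integral>z. \<bar>S z\<bar> \<partial>?P) \<le> 2 * b * sqrt (real n)"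
    by (rule power2_le_imp_le) (use b0 in auto)
  have "(\<Sum>i<n. h (z i)) / real n - (\<integral>x. h x \<partial>M) = S z / real n" for z
    using n by (simp add: S_def X_def m_def sum_subtractf field_simps)
  then have "(\<integral>z. \<bar>(\<Sum>i<n. h (z i)) / real n - (\<integral>x. h x \<partial>M)\<bar> \<partial>?P) = (\<integral>z. \<bar>S z\<bar> \<partial>?P) / real n"
    by (simp add: abs_divide)
  also have "\<dots> \<le> 2 * b * sqrt (real n) / real n"
    by (intro divide_right_mono first) auto
  also have "\<dots> = 2 * b / sqrt (real n)"
    using n by (simp add: field_simps flip: power2_eq_square)
  finally show ?thesis .
qed

section \<open>Exponentials and logarithms\<close>

lemma measurable_exp_ereal [measurable]: "exp_ereal \<in> borel_measurable borel"
proof -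
  have "exp_ereal = (\<lambda>t. if t = \<infinity> then \<top> else if t = - \<infinity> then 0 else ennreal (exp (real_of_ereal t)))"
    by (auto simp: exp_ereal_def fun_eq_iff split: ereal.splits)
  also have "\<dots> \<in> borel_measurable borel" by measurable
  finally show ?thesis .
qed

lemma measurable_ln_ennreal [measurable]: "ln_ennreal \<in> borel_measurable borel"
  unfolding ln_ennreal_def by measurable

lemma exp_ereal_mono: "s \<le> t \<Longrightarrow> exp_ereal s \<le> exp_ereal t"
  by (cases s; cases t) (auto simp: exp_ereal_def)

lemma ln_ennreal_le:
  assumes "t \<le> ennreal (exp a)"
  shows "ln_ennreal t \<le> ereal a"
proof (cases t)
  case (real r)
  then have "r > 0 \<Longrightarrow> ln r \<le> a"
    using assms ln_le_cancel_iff[of r "exp a"] by simp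
  then show ?thesis using real by (auto simp: ln_ennreal_def)
qed (use assms in \<open>auto simp: top_unique\<close>)

lemma ln_ennreal_ge:
  assumes "ennreal (exp a) \<le> t"
  shows "ereal a \<le> ln_ennreal t"
proof (cases t)
  case (real r)
  then have "exp a \<le> r" using assms by simp
  then have "a \<le> ln r" "r > 0" using ln_ge_iff[of r a] exp_gt_zero[of a] by linarith+
  then show ?thesis using real by (auto simp: ln_ennreal_def)
qed (simp add: ln_ennreal_def)

section \<open>Monotone approximation of the kernel\<close>

text \<open>Extended-real addition is continuous away from infinity minus infinity, a case ruled out
  because no limit is minus infinity.\<close>

lemma tendsto_ereal_sum:
  fixes h :: "nat \<Rightarrow> nat \<Rightarrow> real" and g :: "nat \<Rightarrow> ereal"
  assumes "\<And>i. i < n \<Longrightarrow> (\<lambda>k. ereal (h k i)) \<longlonglongrightarrow> g i" "\<And>i. i < n \<Longrightarrow> g i \<noteq> - \<infinity>"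
  shows "(\<lambda>k. ereal (\<Sum>i<n. h k i)) \<longlonglongrightarrow> (\<Sum>i<n. g i)"
  using assms
proof (induction n)
  case (Suc n)
  have "(\<Sum>i<m. g i) \<noteq> - \<infinity>" if "m \<le> n" for m
    using that by (induction m) (use Suc.prems(2) in auto)
  then have "(\<Sum>i<n. g i) \<noteq> - \<infinity>" by simp
  then have "(\<lambda>k. ereal (\<Sum>i<n. h k i) + ereal (h k n)) \<longlonglongrightarrow> (\<Sum>i<n. g i) + g n"
    by (intro tendsto_add_ereal_general Suc) (use Suc.prems in auto)
  then show ?case by simp
qed (simp add: zero_ereal_def)

text \<open>Symmetry, lower bound and measurability of \<open>G\<close> are all inherited from the
  approximants as limits. The bound \<open>f_up\<close> also limits the diagonal contribution in the
  comparison with empirical energies.\<close>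

locale conditional_gas =
  fixes G :: "'a::metric_space \<Rightarrow> 'a \<Rightarrow> ereal" and f :: "nat \<Rightarrow> 'a \<Rightarrow> 'a \<Rightarrow> real"
    and B :: real and K :: "'a set" and \<nu> :: "'a measure"
  assumes compact: "compact (UNIV :: 'a set)"
    and f_continuous: "\<And>k. continuous_on UNIV (\<lambda>(x, y). f k x y)"
    and f_sym: "\<And>k x y. f k x y = f k y x"
    and f_low: "\<And>k x y. - B \<le> f k x y" and B: "0 \<le> B"
    and f_up: "\<And>k x y. f k x y \<le> real k"
    and f_incseq: "\<And>x y. incseq (\<lambda>k. f k x y)"
    and f_lim: "\<And>x y. (\<lambda>k. ereal (f k x y)) \<longlonglongrightarrow> G x y"
    and \<nu>: "\<nu> \<in> prob_measures" and K: "K = measure_support \<nu>"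
    and regular: "regular_pair G K" and BM: "bernstein_markov G K \<nu>"
begin

lemma kernel: "continuous_kernel (f k)"
  by unfold_locales (fact compact, fact f_continuous)

lemma G_sym: "G x y = G y x"
  using LIMSEQ_unique[OF f_lim[of x y]] f_lim[of y x] by (simp add: f_sym[of _ x y])

lemma G_low: "ereal (- B) \<le> G x y"
  by (rule LIMSEQ_le_const[OF f_lim]) (use f_low in auto)

lemma G_not_MInfty: "G x y \<noteq> - \<infinity>"
  using G_low[of x y] by auto

lemma f_le_G: "ereal (f k x y) \<le> G x y"
  by (rule incseq_le[OF _ f_lim]) (use f_incseq in \<open>auto simp: incseq_def\<close>)

lemma measurable_f: "(\<lambda>(x, y). f k x y) \<in> borel_measurable (borel \<Otimes>\<^sub>M borel)"
  by (rule continuous_kernel.borel_measurable_kernel[OF kernel])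

lemma measurable_G: "(\<lambda>(x, y). G x y) \<in> borel_measurable (borel \<Otimes>\<^sub>M borel)"
proof (rule borel_measurable_LIMSEQ_order)
  show "(\<lambda>k. ereal (case p of (x, y) \<Rightarrow> f k x y)) \<longlonglongrightarrow> (case p of (x, y) \<Rightarrow> G x y)" for p
    using f_lim by (cases p) auto
  show "(\<lambda>p. ereal (case p of (x, y) \<Rightarrow> f k x y)) \<in> borel_measurable (borel \<Otimes>\<^sub>M borel)" for k
    using measurable_f[of k] by measurable
qed

section \<open>Potentials and energies of the approximating kernels\<close>

definition pot :: "nat \<Rightarrow> 'a measure \<Rightarrow> 'a \<Rightarrow> real" where
  "pot k \<mu> x = (\<integral>y. f k x y \<partial>\<mu>)"

definition energy :: "nat \<Rightarrow> 'a measure \<Rightarrow> real" where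
  "energy k \<mu> = (\<integral>x. pot k \<mu> x \<partial>\<mu>)"

lemma pot_continuous: "\<mu> \<in> prob_measures \<Longrightarrow> continuous_on UNIV (pot k \<mu>)"
  unfolding pot_def by (rule continuous_kernel.continuous_integral[OF kernel])

lemma integrable_f: "\<mu> \<in> prob_measures \<Longrightarrow> integrable \<mu> (f k x)"
  by (rule continuous_kernel.integrable_section[OF kernel])

lemma integrable_pot: "\<mu> \<in> prob_measures \<Longrightarrow> \<sigma> \<in> prob_measures \<Longrightarrow> integrable \<mu> (pot k \<sigma>)"
  by (rule integrable_prob_measures[OF compact pot_continuous])

lemma pot_bounds:
  assumes "\<mu> \<in> prob_measures"
  shows "- B \<le> pot k \<mu> x" "pot k \<mu> x \<le> real k"
proof -
  interpret prob_space \<mu> by (rule prob_measuresD[OF assms])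
  have "(\<integral>y. - B \<partial>\<mu>) \<le> pot k \<mu> x" "pot k \<mu> x \<le> (\<integral>y. real k \<partial>\<mu>)"
    unfolding pot_def by (intro integral_mono integrable_f assms f_low f_up; simp)+
  then show "- B \<le> pot k \<mu> x" "pot k \<mu> x \<le> real k" by (simp_all add: prob_space)
qed

lemma energy_lower: assumes "\<mu> \<in> prob_measures" shows "- B \<le> energy k \<mu>"
proof -
  interpret prob_space \<mu> by (rule prob_measuresD[OF assms])
  have "(\<integral>y. - B \<partial>\<mu>) \<le> energy k \<mu>"
    unfolding energy_def by (intro integral_mono integrable_pot assms pot_bounds; simp)
  then show ?thesis by (simp add: prob_space)
qed

lemma pot_incseq:
  assumes "\<mu> \<in> prob_measures" shows "incseq (\<lambda>k. pot k \<mu> x)"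
proof (rule incseq_SucI)
  show "pot k \<mu> x \<le> pot (Suc k) \<mu> x" for k
    unfolding pot_def by (intro integral_mono integrable_f assms) (use f_incseq in \<open>auto simp: incseq_Suc_iff\<close>)
qed

lemma energy_incseq:
  assumes "\<mu> \<in> prob_measures" shows "incseq (\<lambda>k. energy k \<mu>)"
proof (rule incseq_SucI)
  show "energy k \<mu> \<le> energy (Suc k) \<mu>" for k
    unfolding energy_def
    by (intro integral_mono integrable_pot assms) (use pot_incseq[OF assms] in \<open>auto simp: incseq_Suc_iff\<close>)
qed

lemma pot_tendsto:
  assumes "\<mu> \<in> prob_measures"
  shows "(\<lambda>k. ereal (pot k \<mu> x)) \<longlonglongrightarrow> potential G \<mu> x"
  unfolding pot_def potential_def
  by (rule ext_integral_monotone_convergence[where B=B and A=real])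
     (use prob_measuresD[OF assms] integrable_f[OF assms] f_low B f_up f_incseq f_lim in auto)

lemma energy_tendsto:
  assumes "\<mu> \<in> prob_measures"
  shows "(\<lambda>k. ereal (energy k \<mu>)) \<longlonglongrightarrow> interaction_energy G \<mu>"
proof -
  have "energy k \<mu> = (\<integral>p. (case p of (x, y) \<Rightarrow> f k x y) \<partial>(\<mu> \<Otimes>\<^sub>M \<mu>))" for k
    unfolding energy_def pot_def by (rule continuous_kernel.Fubini(2)[OF kernel assms assms])
  moreover have "(\<lambda>k. ereal (\<integral>p. (case p of (x, y) \<Rightarrow> f k x y) \<partial>(\<mu> \<Otimes>\<^sub>M \<mu>))) \<longlonglongrightarrow>
      ext_integral (\<mu> \<Otimes>\<^sub>M \<mu>) (\<lambda>(x, y). G x y)"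
  proof (rule ext_integral_monotone_convergence[where B=B and A=real])
    interpret prob_space \<mu> by (rule prob_measuresD[OF assms])
    interpret pair_prob_space \<mu> \<mu> ..
    show "prob_space (\<mu> \<Otimes>\<^sub>M \<mu>)" by unfold_locales
    show "(\<lambda>p. case p of (x, y) \<Rightarrow> f k x y) \<in> borel_measurable (\<mu> \<Otimes>\<^sub>M \<mu>)" for k
      using continuous_kernel.integrable_pair[OF kernel assms assms] by (rule borel_measurable_integrable)
  qed (use f_low B f_up f_incseq f_lim in auto)
  ultimately show ?thesis by (simp add: interaction_energy_def)
qed

lemma pot_le_potential: "\<mu> \<in> prob_measures \<Longrightarrow> ereal (pot k \<mu> x) \<le> potential G \<mu> x"
  by (rule incseq_le[OF _ pot_tendsto]) (use pot_incseq in \<open>auto simp: incseq_def\<close>)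

lemma energy_le: "\<mu> \<in> prob_measures \<Longrightarrow> ereal (energy k \<mu>) \<le> interaction_energy G \<mu>"
  by (rule incseq_le[OF _ energy_tendsto]) (use energy_incseq in \<open>auto simp: incseq_def\<close>)

lemma potential_low: "\<mu> \<in> prob_measures \<Longrightarrow> ereal (- B) \<le> potential G \<mu> x"
  using pot_le_potential[of \<mu> 0 x] pot_bounds(1)[of \<mu> 0 x] by (metis ereal_less_eq(3) order_trans)

lemma interaction_energy_low: "\<mu> \<in> prob_measures \<Longrightarrow> ereal (- B) \<le> interaction_energy G \<mu>"
  using energy_le[of \<mu> 0] energy_lower[of \<mu> 0] by (metis ereal_less_eq(3) order_trans)

text \<open>Fubini and symmetry give this for each bounded kernel \<open>f k\<close>; monotone
  convergence carries it to \<open>G\<close>, infinite values included.\<close>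

lemma potential_reciprocity:
  assumes "\<mu> \<in> prob_measures" "\<sigma> \<in> prob_measures"
  shows "ext_integral \<mu> (potential G \<sigma>) = ext_integral \<sigma> (potential G \<mu>)"
proof -
  have lim: "(\<lambda>k. ereal (\<integral>x. pot k \<rho>' x \<partial>\<rho>)) \<longlonglongrightarrow> ext_integral \<rho> (potential G \<rho>')"
    if "\<rho> \<in> prob_measures" "\<rho>' \<in> prob_measures" for \<rho> \<rho>'
    by (rule ext_integral_monotone_convergence[where B=B and A=real])
       (use that prob_measuresD integrable_pot B pot_bounds pot_incseq pot_tendsto in auto)
  have "(\<integral>x. pot k \<sigma> x \<partial>\<mu>) = (\<integral>x. pot k \<mu> x \<partial>\<sigma>)" for k
    unfolding pot_def continuous_kernel.Fubini(1)[OF kernel assms] by (subst f_sym) simp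
  then show ?thesis using LIMSEQ_unique[OF lim[OF assms]] lim[OF assms(2,1)] by simp
qed

section \<open>The infimum of the potential over the support\<close>

abbreviation inf_potential :: "'a measure \<Rightarrow> ereal" where
  "inf_potential \<mu> \<equiv> INF x\<in>K. potential G \<mu> x"

definition test_measure :: "'a measure \<Rightarrow> bool" where
  "test_measure \<sigma> \<longleftrightarrow> \<sigma> \<in> prob_measures \<and> (AE x in \<sigma>. x \<in> K) \<and>
     (\<forall>x. \<bar>potential G \<sigma> x\<bar> \<noteq> \<infinity>) \<and> continuous_on UNIV (potential G \<sigma>)"

text \<open>A real-valued copy of the potential, so that it can serve as a test function of the weak
  topology.\<close>

definition tpot :: "'a measure \<Rightarrow> 'a \<Rightarrow> real" where
  "tpot \<sigma> x = real_of_ereal (potential G \<sigma> x)"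

lemma tpot: "test_measure \<sigma> \<Longrightarrow> ereal (tpot \<sigma> x) = potential G \<sigma> x"
  unfolding test_measure_def tpot_def by (metis ereal_real')

lemma tpot_continuous:
  assumes "test_measure \<sigma>" shows "continuous_on UNIV (tpot \<sigma>)"
  using assms continuous_on_iff_real[of UNIV "potential G \<sigma>"]
  by (simp add: test_measure_def tpot_def[abs_def] comp_def)

lemma integrable_tpot: "test_measure \<sigma> \<Longrightarrow> \<mu> \<in> prob_measures \<Longrightarrow> integrable \<mu> (tpot \<sigma>)"
  by (rule integrable_prob_measures[OF compact tpot_continuous])

lemma integral_tpot:
  assumes "test_measure \<sigma>" "\<mu> \<in> prob_measures"
  shows "ereal (\<integral>x. tpot \<sigma> x \<partial>\<mu>) = ext_integral \<sigma> (potential G \<mu>)"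
proof -
  have "\<sigma> \<in> prob_measures" using assms(1) by (simp add: test_measure_def)
  then show ?thesis
    using ext_integral_ereal[OF integrable_tpot[OF assms]] potential_reciprocity[OF assms(2)]
    by (simp add: tpot[OF assms(1)])
qed

text \<open>Averaging the potential of \<open>\<mu>\<close> over a measure carried by K gives at
  least its infimum there, and reciprocity turns that average into an integral against
  \<open>\<mu>\<close>.\<close>

lemma inf_potential_le:
  assumes \<sigma>: "test_measure \<sigma>" and \<mu>: "\<mu> \<in> prob_measures"
  shows "inf_potential \<mu> \<le> ereal (\<integral>x. tpot \<sigma> x \<partial>\<mu>)"
proof (rule ccontr)
  assume "\<not> ?thesis"
  \<comment> \<open>A real number is interposed because the infimum is not yet known to be finite;
    its finiteness is deduced from this lemma.\<close>
  then obtain z where z: "(\<integral>x. tpot \<sigma> x \<partial>\<mu>) < z" "ereal z < inf_potential \<mu>"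
    using ereal_dense2 by (metis less_ereal.simps(1) not_le)
  have \<sigma>': "\<sigma> \<in> prob_measures" "AE x in \<sigma>. x \<in> K" using \<sigma> by (auto simp: test_measure_def)
  have "AE x in \<sigma>. ereal z \<le> potential G \<mu> x"
    using \<sigma>'(2)
  proof eventually_elim
    case (elim x)
    then show ?case using z(2) by (meson INF_lower less_imp_le order_trans)
  qed
  then have "ereal z \<le> ext_integral \<sigma> (potential G \<mu>)"
    using ext_integral_mono_AE[of "\<lambda>_. ereal z" "potential G \<mu>" \<sigma>]
      ext_integral_const[OF prob_measuresD(1)[OF \<sigma>'(1)], of z] by simp
  then show False using z(1) by (simp flip: integral_tpot[OF \<sigma> \<mu>])
qed

lemma regular_test_measure:
  assumes "\<mu> \<in> prob_measures" "0 < e"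
  obtains \<sigma> where "test_measure \<sigma>" "AE x in \<sigma>. potential G \<mu> x \<le> inf_potential \<mu> + ereal e"
proof -
  let ?S = "{x \<in> K. potential G \<mu> x \<le> inf_potential \<mu> + ereal e}"
  obtain \<sigma> where \<sigma>: "\<sigma> \<in> prob_measures" "emeasure \<sigma> ?S = 1"
    "\<forall>x. \<bar>potential G \<sigma> x\<bar> \<noteq> \<infinity>" "continuous_on UNIV (potential G \<sigma>)"
    using regular assms unfolding regular_pair_def by blast
  interpret prob_space \<sigma> by (rule prob_measuresD[OF \<sigma>(1)])
  \<comment> \<open>Measurability comes for free: a set outside the sigma-algebra would have
    \<open>emeasure\<close> 0, not 1.\<close>
  have "?S \<in> sets \<sigma>" using \<sigma>(2) emeasure_notin_sets by fastforce
  moreover have "prob ?S = 1" using \<sigma>(2) by (simp add: measure_def)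
  ultimately have "AE x in \<sigma>. x \<in> ?S" using AE_in_set_eq_1 by blast
  then have "test_measure \<sigma>" "AE x in \<sigma>. potential G \<mu> x \<le> inf_potential \<mu> + ereal e"
    using \<sigma> by (auto simp: test_measure_def)
  then show thesis by (rule that)
qed

text \<open>A single test measure bounds the infimum by the integral of a bounded continuous
  function; this also excludes an empty K, over which the infimum would be infinite.\<close>

lemma inf_potential_finite:
  assumes "\<mu> \<in> prob_measures" shows "\<bar>inf_potential \<mu>\<bar> \<noteq> \<infinity>"
proof -
  obtain \<sigma> where "test_measure \<sigma>" using regular_test_measure[OF assms, of 1] by auto
  then have "inf_potential \<mu> \<noteq> \<infinity>" using inf_potential_le[OF _ assms, of \<sigma>] by auto
  moreover have "ereal (- B) \<le> inf_potential \<mu>" by (intro INF_greatest potential_low assms)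
  ultimately show ?thesis by auto
qed

text \<open>Regularity places \<open>\<sigma>\<close> where the potential of \<open>\<mu>\<close> is
  within e of its infimum, and reciprocity transfers the average. With
  \<open>inf_potential_le\<close> this presents the infimum as an infimum of weakly continuous
  functionals.\<close>

lemma test_measure_near_inf:
  assumes \<mu>: "\<mu> \<in> prob_measures" and e: "0 < e"
  obtains \<sigma> where "test_measure \<sigma>" "ereal (\<integral>x. tpot \<sigma> x \<partial>\<mu>) \<le> inf_potential \<mu> + ereal e"
proof -
  obtain \<sigma> where \<sigma>: "test_measure \<sigma>" "AE x in \<sigma>. potential G \<mu> x \<le> inf_potential \<mu> + ereal e"
    using regular_test_measure[OF assms] by blast
  obtain i where i: "inf_potential \<mu> = ereal i" using inf_potential_finite[OF \<mu>] by auto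
  have "prob_space \<sigma>" using \<sigma>(1) prob_measuresD(1) by (auto simp: test_measure_def)
  then have "ext_integral \<sigma> (potential G \<mu>) \<le> ereal (i + e)"
    using ext_integral_mono_AE[OF \<sigma>(2)] ext_integral_const[of \<sigma> "i + e"] i by simp
  then show thesis using that[OF \<sigma>(1)] integral_tpot[OF \<sigma>(1) \<mu>] i by simp
qed

section \<open>The limit functional as a supremum of continuous functionals\<close>

definition minorant :: "nat \<Rightarrow> 'a measure \<Rightarrow> 'a measure \<Rightarrow> real" where
  "minorant k \<sigma> \<mu> = energy k \<mu> / 2 - (\<integral>x. tpot \<sigma> x \<partial>\<mu>)"

lemma minorant_continuous:
  assumes "test_measure \<sigma>"
  shows "continuous_map weak_topology euclideanreal (minorant k \<sigma>)"
proof -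
  have "continuous_map weak_topology euclideanreal (energy k)"
    unfolding energy_def pot_def
    by (rule continuous_kernel.continuous_map_energy[OF kernel]) (rule f_sym)
  then have "continuous_map weak_topology euclideanreal
      (\<lambda>\<mu>. (1 / 2) * energy k \<mu> - (\<integral>x. tpot \<sigma> x \<partial>\<mu>))"
    by (intro continuous_map_diff continuous_map_real_mult_left
        continuous_map_weak_integral compact tpot_continuous assms)
  then show ?thesis by (simp add: minorant_def[abs_def])
qed

lemma minorant_le:
  assumes "test_measure \<sigma>" "\<mu> \<in> prob_measures"
  shows "ereal (minorant k \<sigma> \<mu>) \<le> conditional_limit G K \<mu>"
proof -
  obtain i where i: "inf_potential \<mu> = ereal i" using inf_potential_finite[OF assms(2)] by auto
  have "i \<le> (\<integral>x. tpot \<sigma> x \<partial>\<mu>)" using inf_potential_le[OF assms] i by simp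
  then have "ereal (minorant k \<sigma> \<mu>) \<le> ereal (1 / 2) * ereal (energy k \<mu>) - ereal i"
    by (simp add: minorant_def)
  also have "\<dots> \<le> ereal (1 / 2) * interaction_energy G \<mu> - ereal i"
    by (intro ereal_minus_mono ereal_mult_left_mono energy_le assms) auto
  finally show ?thesis by (simp add: conditional_limit_def i)
qed

text \<open>Since the infimum is finite, subtracting it preserves the monotone limit of the energies
  even when that limit is infinite. So k is fixed first, and the test measure is chosen within the
  gap that remains.\<close>

lemma less_minorant:
  assumes \<mu>: "\<mu> \<in> prob_measures" and a: "ereal a < conditional_limit G K \<mu>"
  obtains k \<sigma> where "test_measure \<sigma>" "a < minorant k \<sigma> \<mu>"
proof -
  obtain i where i: "inf_potential \<mu> = ereal i" using inf_potential_finite[OF \<mu>] by auto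
  have "(\<lambda>k. ereal (1 / 2) * ereal (energy k \<mu>) - ereal i) \<longlonglongrightarrow>
      ereal (1 / 2) * interaction_energy G \<mu> - ereal i"
    by (intro tendsto_diff_ereal_general tendsto_cmult_ereal energy_tendsto \<mu> tendsto_const) auto
  then have "\<forall>\<^sub>F k in sequentially. ereal a < ereal (1 / 2) * ereal (energy k \<mu>) - ereal i"
    using a unfolding conditional_limit_def i by (rule order_tendstoD)
  then obtain k where "ereal a < ereal (1 / 2) * ereal (energy k \<mu>) - ereal i"
    by (auto simp: eventually_sequentially)
  then have k: "a < energy k \<mu> / 2 - i" by simp
  \<comment> \<open>Half of the gap: the test measure overshoots the infimum by at most e, which
    leaves the minorant above a.\<close>
  define e where "e = (energy k \<mu> / 2 - i - a) / 2"
  have "0 < e" using k by (simp add: e_def)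
  then obtain \<sigma> where "test_measure \<sigma>" "ereal (\<integral>x. tpot \<sigma> x \<partial>\<mu>) \<le> inf_potential \<mu> + ereal e"
    using test_measure_near_inf[OF \<mu>] by blast
  then show thesis using k i by (intro that[of \<sigma> k]) (auto simp: minorant_def e_def field_simps)
qed

lemma conditional_limit_not_MInfty:
  assumes "\<mu> \<in> prob_measures" shows "conditional_limit G K \<mu> \<noteq> - \<infinity>"
proof -
  obtain \<sigma> where "test_measure \<sigma>" using regular_test_measure[OF assms, of 1] by auto
  then show ?thesis using minorant_le[OF _ assms, of \<sigma> 0] by auto
qed

text \<open>The supremum runs over a possibly uncountable family of test measures, so measurability
  is obtained from open superlevel sets rather than from countable suprema.\<close>

lemma openin_conditional_limit_greater:
  "openin weak_topology {\<mu> \<in> prob_measures. a < conditional_limit G K \<mu>}"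
proof (cases a)
  case (real r)
  have "{\<mu> \<in> prob_measures. a < conditional_limit G K \<mu>} =
      (\<Union>(k, \<sigma>) \<in> UNIV \<times> {\<sigma>. test_measure \<sigma>}. {\<mu> \<in> prob_measures. minorant k \<sigma> \<mu> \<in> {r<..}})"
    (is "?L = ?R")
  proof (intro equalityI subsetI)
    fix \<mu> assume "\<mu> \<in> ?L"
    then have "\<mu> \<in> prob_measures" "ereal r < conditional_limit G K \<mu>" using real by auto
    from less_minorant[OF this] show "\<mu> \<in> ?R" using \<open>\<mu> \<in> prob_measures\<close> by auto blast
  next
    fix \<mu> assume "\<mu> \<in> ?R"
    then obtain k \<sigma> where "test_measure \<sigma>" "\<mu> \<in> prob_measures" "r < minorant k \<sigma> \<mu>" by auto
    then show "\<mu> \<in> ?L" using minorant_le[of \<sigma> \<mu> k] real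
      by (auto intro: less_le_trans[of "ereal r" "ereal (minorant k \<sigma> \<mu>)"])
  qed
  moreover have "openin weak_topology {\<mu> \<in> prob_measures. minorant k \<sigma> \<mu> \<in> {r<..}}"
    if "test_measure \<sigma>" for k \<sigma>
    using openin_continuous_map_preimage[OF minorant_continuous[OF that], of "{r<..}" k]
    by (simp add: topspace_weak_topology)
  ultimately show ?thesis by (auto intro!: openin_Union)
next
  case MInf
  then have "{\<mu> \<in> prob_measures. a < conditional_limit G K \<mu>} = prob_measures"
    using conditional_limit_not_MInfty by auto
  then show ?thesis by (metis openin_topspace topspace_weak_topology)
qed simp

lemma measurable_conditional_limit: "conditional_limit G K \<in> borel_measurable weak_borel"
proof (rule borel_measurableI_greater)
  have sub: "{A. openin weak_topology A} \<subseteq> Pow prob_measures"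
    using openin_subset topspace_weak_topology by blast
  fix a
  show "{\<mu> \<in> space weak_borel. a < conditional_limit G K \<mu>} \<in> sets weak_borel"
    unfolding weak_borel_def space_measure_of[OF sub] sets_measure_of[OF sub]
    by (rule sigma_sets.Basic) (simp add: openin_conditional_limit_greater)
qed

end

section \<open>Pair sums\<close>

text \<open>The triangle and its mirror image tile the off-diagonal square. Stating it as a doubling
  avoids division and subtraction, so it applies to extended reals.\<close>

lemma pair_sum_offdiagonal:
  fixes g :: "nat \<Rightarrow> nat \<Rightarrow> 'b::comm_monoid_add"
  assumes "\<And>i j. g i j = g j i"
  shows "(\<Sum>j<n. \<Sum>i<j. g i j) + (\<Sum>j<n. \<Sum>i<j. g i j) =
    (\<Sum>p\<in>{p. fst p < n \<and> snd p < n \<and> fst p \<noteq> snd p}. g (fst p) (snd p))"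
proof -
  let ?A = "SIGMA j:{..<n}. {..<j}"
  have eq: "(\<Sum>j<n. \<Sum>i<j. g i j) = (\<Sum>p\<in>?A. g (fst p) (snd p))"
    by (subst sum.Sigma) (auto intro!: sum.cong simp: assms)
  have sw: "(\<Sum>p\<in>?A. g (fst p) (snd p)) = (\<Sum>p\<in>prod.swap ` ?A. g (fst p) (snd p))"
    by (subst sum.reindex) (auto intro!: sum.cong simp: assms)
  have "(\<Sum>j<n. \<Sum>i<j. g i j) + (\<Sum>j<n. \<Sum>i<j. g i j) = (\<Sum>p\<in>?A \<union> prod.swap ` ?A. g (fst p) (snd p))"
    unfolding eq by (subst sum.union_disjoint) (auto simp: sw)
  also have "?A \<union> prod.swap ` ?A = {p. fst p < n \<and> snd p < n \<and> fst p \<noteq> snd p}"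
    by (auto simp: image_iff)
  finally show ?thesis .
qed

text \<open>A permutation need not preserve i < j, but it preserves the off-diagonal square. Hence
  the doubled sums agree, and doubling is injective on extended reals.\<close>

lemma pair_sum_permute:
  fixes g :: "nat \<Rightarrow> nat \<Rightarrow> ereal"
  assumes sym: "\<And>i j. g i j = g j i" and p: "p permutes {..<n}"
  shows "(\<Sum>j<n. \<Sum>i<j. g (p i) (p j)) = (\<Sum>j<n. \<Sum>i<j. g i j)"
proof -
  let ?D = "{q. fst q < n \<and> snd q < n \<and> fst q \<noteq> snd q}"
  have pn: "p i < n \<longleftrightarrow> i < n" for i using permutes_in_image[OF p, of i] by simp
  have inj: "inj p" using p by (rule permutes_inj)
  have "bij_betw (map_prod p p) ?D ?D"
  proof (rule bij_betw_byWitness[where f' = "map_prod (inv p) (inv p)"])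
    have ipn: "inv p i < n \<longleftrightarrow> i < n" for i
      using permutes_in_image[OF permutes_inv[OF p], of i] by simp
    have inji: "inj (inv p)" using permutes_inv[OF p] by (rule permutes_inj)
    show "map_prod (inv p) (inv p) ` ?D \<subseteq> ?D" by (auto simp: ipn inj_eq[OF inji])
    show "map_prod p p ` ?D \<subseteq> ?D" by (auto simp: pn inj_eq[OF inj])
  qed (use permutes_inverses[OF p] in auto)
  from sum.reindex_bij_betw[OF this, of "\<lambda>q. g (fst q) (snd q)"]
  have D: "(\<Sum>q\<in>?D. g (p (fst q)) (p (snd q))) = (\<Sum>q\<in>?D. g (fst q) (snd q))" by simp
  have "(\<Sum>j<n. \<Sum>i<j. g (p i) (p j)) + (\<Sum>j<n. \<Sum>i<j. g (p i) (p j)) =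
      (\<Sum>j<n. \<Sum>i<j. g i j) + (\<Sum>j<n. \<Sum>i<j. g i j)"
    unfolding pair_sum_offdiagonal[of "\<lambda>i j. g (p i) (p j)" n, OF sym] pair_sum_offdiagonal[of g n, OF sym]
    by (rule D)
  then show ?thesis
    by (cases "\<Sum>j<n. \<Sum>i<j. g (p i) (p j)"; cases "\<Sum>j<n. \<Sum>i<j. g i j") auto
qed

lemma pair_sum_real:
  fixes g :: "nat \<Rightarrow> nat \<Rightarrow> real"
  assumes "\<And>i j. g i j = g j i"
  shows "(\<Sum>i<n. \<Sum>j<n. g i j) = 2 * (\<Sum>j<n. \<Sum>i<j. g i j) + (\<Sum>i<n. g i i)"
proof (induction n)
  case (Suc n)
  have "(\<Sum>i<n. g n i) = (\<Sum>i<n. g i n)" using assms by (intro sum.cong) auto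
  with Suc show ?case by (simp add: sum.distrib)
qed simp

lemma pair_sum_bound:
  fixes g :: "nat \<Rightarrow> nat \<Rightarrow> real"
  assumes "\<And>i j. \<bar>g i j\<bar> \<le> b" "0 \<le> b"
  shows "\<bar>\<Sum>j<n. \<Sum>i<j. g i j\<bar> \<le> real n * (real n * b)"
proof -
  have "\<bar>\<Sum>i<j. g i j\<bar> \<le> real n * b" if "j < n" for j
  proof -
    have "\<bar>\<Sum>i<j. g i j\<bar> \<le> (\<Sum>i<j. b)" by (rule order_trans[OF sum_abs sum_mono]) (use assms in auto)
    also have "\<dots> \<le> real n * b" using that assms(2) by (auto intro!: mult_right_mono)
    finally show ?thesis .
  qed
  then have "\<bar>\<Sum>j<n. \<Sum>i<j. g i j\<bar> \<le> (\<Sum>j<n. real n * b)"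
    by (rule order_trans[OF sum_abs sum_mono]) auto
  then show ?thesis by simp
qed

lemma pair_sum_const: "(\<Sum>j<n. \<Sum>i<j. c) = real n * (real n - 1) / 2 * c"
proof (induction n)
  case (Suc n)
  then show ?case by (simp add: field_simps)
qed simp

lemma ereal_sum_not_MInfty:
  fixes h :: "'b \<Rightarrow> ereal"
  assumes "\<And>i. i \<in> I \<Longrightarrow> h i \<noteq> - \<infinity>"
  shows "sum h I \<noteq> - \<infinity>"
  using assms by (induction I rule: infinite_finite_induct) auto

section \<open>The conditional energies\<close>

context conditional_gas
begin

text \<open>The conditional partition function: the Boltzmann weight of an extra particle y in the
  field of the n particles, integrated over \<open>\<nu>\<close>.\<close>

definition mass :: "nat \<Rightarrow> (nat \<Rightarrow> 'a) \<Rightarrow> ennreal" where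
  "mass n z = (\<integral>\<^sup>+ y. exp_ereal (- (\<Sum>i<n. G y (z i))) \<partial>\<nu>)"

definition pair_energy :: "nat \<Rightarrow> (nat \<Rightarrow> 'a) \<Rightarrow> ereal" where
  "pair_energy n z = (\<Sum>j<n. \<Sum>i<j. G (z i) (z j))"

lemma conditional_energy_alt:
  "conditional_energy G \<nu> n z = ereal (1 / real n ^ 2) * pair_energy n z +
     ereal (real (n + 1) / real n ^ 2) * ln_ennreal (mass n z)"
  by (simp add: conditional_energy_def mass_def pair_energy_def)

text \<open>Lets estimates on the potentials \<open>pot k\<close> of an empirical measure, which are
  plain averages, pass to the field generated by \<open>G\<close>.\<close>

lemma field_sum_le:
  fixes n :: nat
  assumes "\<And>k. (\<Sum>i<n. f k y (z i)) \<le> r"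
  shows "(\<Sum>i<n. G y (z i)) \<le> ereal r"
proof -
  have "(\<lambda>k. ereal (\<Sum>i<n. f k y (z i))) \<longlonglongrightarrow> (\<Sum>i<n. G y (z i))"
    by (rule tendsto_ereal_sum[of n "\<lambda>k i. f k y (z i)" "\<lambda>i. G y (z i)"]) (auto simp: f_lim G_not_MInfty)
  then show ?thesis
    by (rule LIMSEQ_le_const2) (use assms in auto)
qed

section \<open>Lower bounds for the conditional energies through empirical measures\<close>

lemma integral_f_empirical:
  "(\<integral>y. f k x y \<partial>(empirical_measure n z)) = (\<Sum>i<n. f k x (z i)) / real n"
  by (rule integral_empirical_measure)
     (rule borel_measurable_continuous_onI[OF continuous_kernel.continuous_section[OF kernel]])

lemma energy_empirical:
  assumes "0 < n"
  shows "energy k (empirical_measure n z) = (\<Sum>i<n. \<Sum>j<n. f k (z i) (z j)) / (real n)\<^sup>2"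
proof -
  have "energy k (empirical_measure n z) = (\<Sum>i<n. pot k (empirical_measure n z) (z i)) / real n"
    unfolding energy_def
    by (rule integral_empirical_measure[OF borel_measurable_continuous_onI[OF pot_continuous]])
       (rule empirical_measure_prob[OF assms])
  then show ?thesis
    by (simp add: pot_def integral_f_empirical power2_eq_square flip: sum_divide_distrib)
qed

text \<open>The full double sum of \<open>f k\<close> is twice the triangular sum plus the diagonal.
  The diagonal is at most n k, which becomes k/(2n) after division by 2 n^2.\<close>

lemma pair_energy_ge:
  assumes n: "0 < n"
  shows "ereal (energy k (empirical_measure n z) / 2 - real k / (2 * real n)) \<le>
    ereal (1 / real n ^ 2) * pair_energy n z"
proof -
  let ?s = "\<Sum>j<n. \<Sum>i<j. f k (z i) (z j)"
  have "(\<Sum>i<n. f k (z i) (z i)) \<le> (\<Sum>i<n. real k)" by (intro sum_mono f_up)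
  then have "(\<Sum>i<n. \<Sum>j<n. f k (z i) (z j)) - real n * real k \<le> 2 * ?s"
    using pair_sum_real[of "\<lambda>i j. f k (z i) (z j)" n] f_sym by simp
  then have "((\<Sum>i<n. \<Sum>j<n. f k (z i) (z j)) - real n * real k) / (2 * real n ^ 2) \<le>
      2 * ?s / (2 * real n ^ 2)"
    by (rule divide_right_mono) simp
  moreover have "((\<Sum>i<n. \<Sum>j<n. f k (z i) (z j)) - real n * real k) / (2 * real n ^ 2) =
      energy k (empirical_measure n z) / 2 - real k / (2 * real n)"
    using n by (simp add: energy_empirical diff_divide_distrib power2_eq_square)
  ultimately have "energy k (empirical_measure n z) / 2 - real k / (2 * real n) \<le> 1 / real n ^ 2 * ?s"
    by simp
  also have "ereal (1 / real n ^ 2 * ?s) \<le> ereal (1 / real n ^ 2) * pair_energy n z"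
    unfolding pair_energy_def times_ereal.simps(1)[symmetric]
    by (intro ereal_mult_left_mono) (auto simp flip: sum_ereal intro!: sum_mono f_le_G)
  finally show ?thesis by simp
qed

text \<open>Some y in K has potential below the test integral plus e, so the section density at y is
  at least exp(-n (v + e)). Bernstein-Markov passes from this value to the integral over
  \<open>\<nu>\<close> at the price of the second e and of ln C, uniformly in n and z.\<close>

lemma ln_mass_ge:
  assumes \<sigma>: "test_measure \<sigma>" and e: "0 < e"
  obtains c where "0 \<le> c" "\<And>n z. 0 < n \<Longrightarrow> z \<in> space (power_space n) \<Longrightarrow>
    ereal (- real n * ((\<integral>x. tpot \<sigma> x \<partial>(empirical_measure n z)) + 2 * e) - c) \<le> ln_ennreal (mass n z)"
proof -
  obtain C where C: "C > 0" "\<And>n z. 0 < n \<Longrightarrow> z \<in> space (power_space n) \<Longrightarrow>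
      (SUP y\<in>K. section_density G n z y)
        \<le> ennreal (C * exp (e * real n)) * (\<integral>\<^sup>+ y. section_density G n z y \<partial>\<nu>)"
    using BM[unfolded bernstein_markov_def, rule_format, OF e] by (elim exE conjE) simp
  show thesis
  \<comment> \<open>The absolute value makes the constant nonnegative, as later estimates
    require.\<close>
  proof (rule that[of "\<bar>ln C\<bar>"])
    fix n and z :: "nat \<Rightarrow> 'a" assume n: "0 < n" and z: "z \<in> space (power_space n)"
    let ?\<mu> = "empirical_measure n z"
    define v where "v = (\<integral>x. tpot \<sigma> x \<partial>?\<mu>)"
    have \<mu>: "?\<mu> \<in> prob_measures" by (rule empirical_measure_prob[OF n])
    have "inf_potential ?\<mu> < ereal (v + e)"
      using inf_potential_le[OF \<sigma> \<mu>] e unfolding v_def by (auto intro: le_less_trans)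
    then obtain y where y: "y \<in> K" "potential G ?\<mu> y < ereal (v + e)"
      by (auto simp: INF_less_iff)
    have "(\<Sum>i<n. f k y (z i)) \<le> real n * (v + e)" for k
    proof -
      have "ereal (pot k ?\<mu> y) < ereal (v + e)" using pot_le_potential[OF \<mu>] y(2) by (rule le_less_trans)
      then show ?thesis using n by (simp add: pot_def integral_f_empirical field_simps)
    qed
    then have "(\<Sum>i<n. G y (z i)) \<le> ereal (real n * (v + e))" by (rule field_sum_le)
    then have "exp_ereal (ereal (- (real n * (v + e)))) \<le> section_density G n z y"
      unfolding section_density_def by (intro exp_ereal_mono) (simp add: G_sym[of _ y] flip: uminus_ereal.simps(1))
    also have "\<dots> \<le> (SUP y\<in>K. section_density G n z y)" using y(1) by (rule SUP_upper)
    \<comment> \<open>\<open>section_density\<close> has the particles in the first argument of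
      \<open>G\<close> and \<open>mass\<close> has them in the second; symmetry identifies the
      two.\<close>
    also have "\<dots> \<le> ennreal (C * exp (e * real n)) * mass n z"
      using C(2)[OF n z] unfolding mass_def section_density_def by (simp add: G_sym[of "z _"])
    finally have le: "ennreal (exp (- (real n * (v + e)))) \<le> ennreal (C * exp (e * real n)) * mass n z"
      by (simp add: exp_ereal_def)
    have "ennreal (exp (- real n * (v + 2 * e) - ln C)) \<le> mass n z"
    proof (cases "mass n z")
      case (real q)
      then have "exp (- (real n * (v + e))) \<le> C * exp (e * real n) * q"
        using le C(1) by (simp add: ennreal_mult[symmetric])
      moreover have "exp (- real n * (v + 2 * e) - ln C) = exp (- (real n * (v + e))) / (C * exp (e * real n))"
      proof -
        have "- real n * (v + 2 * e) - ln C = - (real n * (v + e)) - (ln C + e * real n)"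
          by (simp add: algebra_simps)
        then show ?thesis using C(1) by (simp only: exp_diff exp_add exp_ln)
      qed
      ultimately show ?thesis using real C(1) by (simp add: divide_le_eq mult.commute)
    qed simp
    then have "ereal (- real n * (v + 2 * e) - ln C) \<le> ln_ennreal (mass n z)" by (rule ln_ennreal_ge)
    moreover have "ereal (- real n * (v + 2 * e) - \<bar>ln C\<bar>) \<le> ereal (- real n * (v + 2 * e) - ln C)" by simp
    ultimately show "ereal (- real n * ((\<integral>x. tpot \<sigma> x \<partial>?\<mu>) + 2 * e) - \<bar>ln C\<bar>) \<le> ln_ennreal (mass n z)"
      unfolding v_def by order
  qed simp
qed

lemma tpot_bound:
  assumes "test_measure \<sigma>"
  obtains A where "0 \<le> A" "\<And>\<mu>. \<mu> \<in> prob_measures \<Longrightarrow> \<bar>\<integral>x. tpot \<sigma> x \<partial>\<mu>\<bar> \<le> A"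
proof -
  obtain A where A: "\<And>x. \<bar>tpot \<sigma> x\<bar> \<le> A"
    using bounded_range_compact[OF compact tpot_continuous[OF assms]] by (auto simp: bounded_iff)
  show thesis
  proof (rule that[of A])
    show "0 \<le> A" using A[of undefined] by linarith
    fix \<mu> :: "'a measure" assume \<mu>: "\<mu> \<in> prob_measures"
    interpret prob_space \<mu> by (rule prob_measuresD[OF \<mu>])
    have "\<bar>\<integral>x. tpot \<sigma> x \<partial>\<mu>\<bar> \<le> (\<integral>x. \<bar>tpot \<sigma> x\<bar> \<partial>\<mu>)" by (rule integral_abs_bound)
    also have "\<dots> \<le> (\<integral>x. A \<partial>\<mu>)"
      by (intro integral_mono) (use A integrable_tpot[OF assms \<mu>] in auto)
    finally show "\<bar>\<integral>x. tpot \<sigma> x \<partial>\<mu>\<bar> \<le> A" by (simp add: prob_space)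
  qed
qed

lemma conditional_energy_ge:
  assumes \<sigma>: "test_measure \<sigma>" and e: "0 < e"
  obtains c where "0 \<le> c" "\<And>n z. 0 < n \<Longrightarrow> z \<in> space (power_space n) \<Longrightarrow>
    ereal (minorant k \<sigma> (empirical_measure n z) - c / real n - 4 * e) \<le> conditional_energy G \<nu> n z"
proof -
  obtain c where c: "0 \<le> c" "\<And>n z. 0 < n \<Longrightarrow> z \<in> space (power_space n) \<Longrightarrow>
    ereal (- real n * ((\<integral>x. tpot \<sigma> x \<partial>(empirical_measure n z)) + 2 * e) - c) \<le> ln_ennreal (mass n z)"
    using ln_mass_ge[OF \<sigma> e] by blast
  obtain A where A: "0 \<le> A" "\<And>\<mu>. \<mu> \<in> prob_measures \<Longrightarrow> \<bar>\<integral>x. tpot \<sigma> x \<partial>\<mu>\<bar> \<le> A"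
    using tpot_bound[OF \<sigma>] by blast
  show thesis
  \<comment> \<open>With t = 1/n: k/2 pays for the diagonal, A for the surplus t v in (1 + t) v, and
    2c for (1 + t) c t. Likewise (1 + t) 2e is at most 4e.\<close>
  proof (rule that[of "real k / 2 + A + 2 * c"])
    show "0 \<le> real k / 2 + A + 2 * c" using A c by simp
    fix n and z :: "nat \<Rightarrow> 'a" assume n: "0 < n" and z: "z \<in> space (power_space n)"
    let ?\<mu> = "empirical_measure n z"
    define v where "v = (\<integral>x. tpot \<sigma> x \<partial>?\<mu>)"
    have v: "\<bar>v\<bar> \<le> A" unfolding v_def by (rule A(2)[OF empirical_measure_prob[OF n]])
    define t where "t = 1 / real n"
    have t: "0 < t" "t \<le> 1" using n by (auto simp: t_def)
    have "(1 + t) * (v + 2 * e + c * t) \<le> v + A * t + 4 * e + 2 * c * t"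
    proof -
      have "t * v \<le> t * A" using v t by (intro mult_left_mono) auto
      moreover have "t * (2 * e) \<le> 1 * (2 * e)" "t * (c * t) \<le> 1 * (c * t)"
        using t e c(1) by (intro mult_right_mono; simp)+
      ultimately show ?thesis by (simp add: algebra_simps)
    qed
    moreover have "real (n + 1) / real n ^ 2 * (- real n * (v + 2 * e) - c) = - ((1 + t) * (v + 2 * e + c * t))"
      using n by (simp add: t_def field_simps power2_eq_square)
    ultimately have 1: "minorant k \<sigma> ?\<mu> - (real k / 2 + A + 2 * c) / real n - 4 * e \<le>
        (energy k ?\<mu> / 2 - real k / (2 * real n)) + real (n + 1) / real n ^ 2 * (- real n * (v + 2 * e) - c)"
      by (simp add: minorant_def v_def[symmetric] t_def add_divide_distrib)
    have 2: "ereal (real (n + 1) / real n ^ 2 * (- real n * (v + 2 * e) - c)) \<le>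
        ereal (real (n + 1) / real n ^ 2) * ln_ennreal (mass n z)"
      unfolding times_ereal.simps(1)[symmetric] v_def by (intro ereal_mult_left_mono c(2) n z) auto
    have "ereal (minorant k \<sigma> ?\<mu> - (real k / 2 + A + 2 * c) / real n - 4 * e) \<le>
        ereal (energy k ?\<mu> / 2 - real k / (2 * real n)) +
        ereal (real (n + 1) / real n ^ 2 * (- real n * (v + 2 * e) - c))"
      using 1 by simp
    also have "\<dots> \<le> conditional_energy G \<nu> n z"
      unfolding conditional_energy_alt by (intro add_mono pair_energy_ge n 2)
    finally show "ereal (minorant k \<sigma> ?\<mu> - (real k / 2 + A + 2 * c) / real n - 4 * e) \<le>
        conditional_energy G \<nu> n z" .
  qed
qed

text \<open>One test measure with k = 0 and e = 1 suffices, since its minorant is bounded below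
  uniformly over all probability measures.\<close>

lemma conditional_energy_stable:
  "\<exists>C::real. \<forall>n>0. \<forall>z\<in>space (power_space n). ereal C \<le> conditional_energy G \<nu> n z"
proof -
  obtain \<sigma> where \<sigma>: "test_measure \<sigma>" using regular_test_measure[OF \<nu>, of 1] by auto
  obtain c where c: "0 \<le> c" "\<And>n z. 0 < n \<Longrightarrow> z \<in> space (power_space n) \<Longrightarrow>
    ereal (minorant 0 \<sigma> (empirical_measure n z) - c / real n - 4 * 1) \<le> conditional_energy G \<nu> n z"
    using conditional_energy_ge[OF \<sigma>, of 1 0] by auto
  obtain A where A: "0 \<le> A" "\<And>\<mu>. \<mu> \<in> prob_measures \<Longrightarrow> \<bar>\<integral>x. tpot \<sigma> x \<partial>\<mu>\<bar> \<le> A"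
    using tpot_bound[OF \<sigma>] by blast
  show ?thesis
  \<comment> \<open>Half the energy is at least -B/2, the test integral is at most A, c/n is at most
    c, and 4 is 4e for e = 1.\<close>
  proof (intro exI[of _ "- B / 2 - A - c - 4"] allI impI ballI)
    fix n and z :: "nat \<Rightarrow> 'a" assume n: "0 < n" and z: "z \<in> space (power_space n)"
    have \<mu>: "empirical_measure n z \<in> prob_measures" by (rule empirical_measure_prob[OF n])
    have "c / real n \<le> c" using n c(1) by (simp add: divide_le_eq mult_le_cancel_left1)
    then have "- B / 2 - A - c - 4 \<le> minorant 0 \<sigma> (empirical_measure n z) - c / real n - 4 * 1"
      using A(2)[OF \<mu>] energy_lower[OF \<mu>, of 0] by (simp add: minorant_def)
    then show "ereal (- B / 2 - A - c - 4) \<le> conditional_energy G \<nu> n z"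
      using c(2)[OF n z] by (meson ereal_less_eq(3) order_trans)
  qed
qed

section \<open>Measurability and symmetry of the conditional energies\<close>

lemma measurable_G_pair:
  assumes "a \<in> measurable N borel" "b \<in> measurable N borel"
  shows "(\<lambda>x. G (a x) (b x)) \<in> borel_measurable N"
  using measurable_compose[OF measurable_Pair[OF assms] measurable_G] by simp

lemma measurable_conditional_energy: "conditional_energy G \<nu> n \<in> borel_measurable (power_space n)"
proof -
  interpret prob_space \<nu> by (rule prob_measuresD[OF \<nu>])
  have [measurable_cong]: "sets \<nu> = sets borel" by (rule prob_measuresD[OF \<nu>])
  have "(\<lambda>(z, y). exp_ereal (- (\<Sum>i<n. G y (z i)))) \<in> borel_measurable (power_space n \<Otimes>\<^sub>M \<nu>)"
  proof -
    have "(\<lambda>p. G (snd p) (fst p i)) \<in> borel_measurable (power_space n \<Otimes>\<^sub>M \<nu>)" if "i \<in> {..<n}" for i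
      by (rule measurable_G_pair) (use that in measurable)
    then have "(\<lambda>p. exp_ereal (- (\<Sum>i<n. G (snd p) (fst p i)))) \<in> borel_measurable (power_space n \<Otimes>\<^sub>M \<nu>)"
      by measurable
    then show ?thesis by (simp add: case_prod_beta')
  qed
  from borel_measurable_nn_integral[OF this]
  have [measurable]: "mass n \<in> borel_measurable (power_space n)" by (simp add: mass_def[abs_def])
  have "(\<lambda>z. G (z i) (z j)) \<in> borel_measurable (power_space n)" if "j \<in> {..<n}" "i \<in> {..<j}" for i j
    by (rule measurable_G_pair; rule measurable_component_singleton) (use that in auto)
  then have [measurable]: "pair_energy n \<in> borel_measurable (power_space n)"
    unfolding pair_energy_def[abs_def] by (intro borel_measurable_ereal_sum) auto
  show ?thesis unfolding conditional_energy_alt[abs_def] by measurable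
qed

lemma conditional_energy_permute:
  assumes "p permutes {..<n}"
  shows "conditional_energy G \<nu> n (z \<circ> p) = conditional_energy G \<nu> n z"
proof -
  have "pair_energy n (z \<circ> p) = pair_energy n z"
    unfolding pair_energy_def comp_def
    by (rule pair_sum_permute[OF _ assms, of "\<lambda>i j. G (z i) (z j)"]) (rule G_sym)
  moreover have "(\<Sum>i<n. G y (z (p i))) = (\<Sum>i<n. G y (z i))" for y
    using sum.permute[OF assms, of "\<lambda>i. G y (z i)"] by (simp add: comp_def)
  ultimately show ?thesis by (simp add: conditional_energy_alt mass_def)
qed

text \<open>A vanishing \<open>mass\<close> would send the logarithm to minus infinity; stability
  excludes this.\<close>

lemma energy_function_conditional_energy:
  assumes "0 < n" shows "energy_function n (conditional_energy G \<nu> n)"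
proof -
  obtain C :: real where C: "\<forall>n>0. \<forall>z\<in>space (power_space n). ereal C \<le> conditional_energy G \<nu> n z"
    using conditional_energy_stable by (rule exE)
  have "conditional_energy G \<nu> n z \<noteq> - \<infinity>" if "z \<in> space (power_space n)" for z
    using C[rule_format, OF assms that] by auto
  then show ?thesis
    unfolding energy_function_def
    using measurable_conditional_energy conditional_energy_permute by simp
qed

text \<open>A level a strictly between the two sides lies below some minorant at
  \<open>\<mu>\<close>. That minorant is weakly continuous, so its values along the sequence stay
  above a and bound the energies from below.\<close>

lemma liminf_lift_energy:
  assumes lim: "limitin weak_topology \<mu>s \<mu> sequentially"
  shows "conditional_limit G K \<mu> \<le> liminf (\<lambda>n. lift_energy n (conditional_energy G \<nu> n) (\<mu>s n))"
proof (rule ccontr)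
  let ?w = "conditional_limit G K \<mu>" and ?l = "\<lambda>n. lift_energy n (conditional_energy G \<nu> n) (\<mu>s n)"
  assume "\<not> ?thesis"
  then obtain a where a: "liminf ?l < ereal a" "ereal a < ?w"
    using ereal_dense2 by (meson not_le)
  have \<mu>: "\<mu> \<in> prob_measures" using limitin_topspace[OF lim] by (simp add: topspace_weak_topology)
  obtain k \<sigma> where \<sigma>: "test_measure \<sigma>" "a < minorant k \<sigma> \<mu>" using less_minorant[OF \<mu> a(2)] by blast
  \<comment> \<open>Then 4e is a third of the gap between a and the minorant.\<close>
  define e where "e = (minorant k \<sigma> \<mu> - a) / 12"
  have e: "0 < e" using \<sigma>(2) by (simp add: e_def)
  obtain c where c: "0 \<le> c" "\<And>n z. 0 < n \<Longrightarrow> z \<in> space (power_space n) \<Longrightarrow>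
    ereal (minorant k \<sigma> (empirical_measure n z) - c / real n - 4 * e) \<le> conditional_energy G \<nu> n z"
    using conditional_energy_ge[OF \<sigma>(1) e, of k] by blast
  have "(\<lambda>n. minorant k \<sigma> (\<mu>s n)) \<longlonglongrightarrow> minorant k \<sigma> \<mu>"
    using continuous_map_limit[OF minorant_continuous[OF \<sigma>(1)] lim, of k] by (simp add: comp_def)
  moreover have "(\<lambda>n. c / real n) \<longlonglongrightarrow> 0" by (rule lim_const_over_n)
  ultimately have "(\<lambda>n. minorant k \<sigma> (\<mu>s n) - c / real n - 4 * e) \<longlonglongrightarrow> minorant k \<sigma> \<mu> - 0 - 4 * e"
    by (intro tendsto_intros)
  moreover have "a < minorant k \<sigma> \<mu> - 0 - 4 * e" using \<sigma>(2) by (simp add: e_def field_simps)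
  ultimately have "\<forall>\<^sub>F n in sequentially. a < minorant k \<sigma> (\<mu>s n) - c / real n - 4 * e"
    by (rule order_tendstoD)
  then have "\<forall>\<^sub>F n in sequentially. ereal a \<le> ?l n"
    using eventually_gt_at_top[of 0]
  proof eventually_elim
    case (elim n)
    show ?case
    proof (cases "\<exists>x\<in>space (power_space n). \<mu>s n = empirical_measure n x")
      case True
      \<comment> \<open>The lower bound depends on x only through its empirical measure, so any
        representative that \<open>SOME\<close> selects will do.\<close>
      define x where "x = (SOME x. x \<in> space (power_space n) \<and> \<mu>s n = empirical_measure n x)"
      have "\<exists>x. x \<in> space (power_space n) \<and> \<mu>s n = empirical_measure n x" using True by blast
      from someI_ex[OF this] have x: "x \<in> space (power_space n)" "\<mu>s n = empirical_measure n x"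
        by (auto simp: x_def)
      have "ereal a \<le> ereal (minorant k \<sigma> (empirical_measure n x) - c / real n - 4 * e)"
        using elim x(2) by simp
      also have "\<dots> \<le> conditional_energy G \<nu> n x" using c(2) elim x(1) by blast
      finally show ?thesis using True by (simp add: lift_energy_def x_def)
    next
      case False
      then have "?l n = \<infinity>" by (simp add: lift_energy_def)
      then show ?thesis by simp
    qed
  qed
  then have "ereal a \<le> liminf ?l" by (rule Liminf_bounded)
  then show False using a(1) by simp
qed

end

section \<open>Recovery sequences\<close>

context conditional_gas
begin

text \<open>Dini's theorem on the compact set \<^term>\<open>K\<close> reduces the kernel \<^term>\<open>G\<close> to a single
  continuous kernel \<^term>\<open>f k\<close>.\<close>

lemma inf_potential_continuous_minorant:
  assumes \<mu>: "\<mu> \<in> prob_measures" and a: "ereal a < inf_potential \<mu>"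
  obtains k where "\<And>x. x \<in> K \<Longrightarrow> a < pot k \<mu> x"
proof -
  have "compact K"
    using closed_measure_support[of \<nu>] compact K compact_Int_closed[of UNIV K] by simp
  have op: "open {x. a < pot k \<mu> x}" for k
    using open_Collect_less[OF continuous_on_const pot_continuous[OF \<mu>]] by simp
  have "K \<subseteq> (\<Union>k\<in>UNIV. {x. a < pot k \<mu> x})"
  proof
    fix x assume "x \<in> K"
    then have "ereal a < potential G \<mu> x" using a by (meson INF_lower less_le_trans)
    with pot_tendsto[OF \<mu>] have "\<forall>\<^sub>F k in sequentially. ereal a < ereal (pot k \<mu> x)"
      by (rule order_tendstoD)
    then show "x \<in> (\<Union>k\<in>UNIV. {x. a < pot k \<mu> x})" by (auto simp: eventually_sequentially)
  qed
  then obtain N where N: "finite N" "K \<subseteq> (\<Union>k\<in>N. {x. a < pot k \<mu> x})"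
    by (rule compactE_image[OF \<open>compact K\<close> op])
  show thesis
  proof (rule that[of "Max (insert 0 N)"])
    fix x assume "x \<in> K"
    then obtain k where k: "k \<in> N" "a < pot k \<mu> x" using N(2) by auto
    have "k \<le> Max (insert 0 N)" using k N(1) by simp
    then show "a < pot (Max (insert 0 N)) \<mu> x"
      using k(2) incseqD[OF pot_incseq[OF \<mu>], of k "Max (insert 0 N)" x] by linarith
  qed
qed

text \<open>The same k and F serve every \<open>\<mu>'\<close>: members of a weakly convergent
  sequence as well as random empirical measures, for which the finite sum is a fluctuation
  controlled by the law of large numbers.\<close>

lemma inf_potential_test_family:
  assumes \<mu>: "\<mu> \<in> prob_measures" and a: "ereal a < inf_potential \<mu>"
  obtains k F where "finite F" "\<And>\<mu>' x. \<mu>' \<in> prob_measures \<Longrightarrow> x \<in> K \<Longrightarrow>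
    a - (\<Sum>c\<in>F. \<bar>pot k \<mu> c - pot k \<mu>' c\<bar>) \<le> pot k \<mu>' x"
proof -
  \<comment> \<open>The room between a and a' absorbs the error of replacing x by a point of the
    net.\<close>
  obtain a' where a': "a < a'" "ereal a' < inf_potential \<mu>"
    using ereal_dense2[OF a] by auto
  obtain k where k: "\<And>x. x \<in> K \<Longrightarrow> a' < pot k \<mu> x"
    using inf_potential_continuous_minorant[OF \<mu> a'(2)] by blast
  obtain F where F: "finite F" "\<And>\<mu> \<mu>' x. \<mu> \<in> prob_measures \<Longrightarrow> \<mu>' \<in> prob_measures \<Longrightarrow>
      \<bar>pot k \<mu> x - pot k \<mu>' x\<bar> \<le> (a' - a) + (\<Sum>c\<in>F. \<bar>pot k \<mu> c - pot k \<mu>' c\<bar>)"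
    unfolding pot_def using continuous_kernel.finite_test_family[OF kernel, of "a' - a" k] a'(1) by auto
  show thesis
  proof (rule that[OF F(1)])
    fix \<mu>' :: "'a measure" and x assume "\<mu>' \<in> prob_measures" "x \<in> K"
    then show "a - (\<Sum>c\<in>F. \<bar>pot k \<mu> c - pot k \<mu>' c\<bar>) \<le> pot k \<mu>' x"
      using F(2)[OF \<mu>, of \<mu>' x] k[of x] by linarith
  qed
qed

lemma eventually_inf_potential_greater:
  assumes \<mu>s: "\<And>n. \<mu>s n \<in> prob_measures" and lim: "limitin weak_topology \<mu>s \<mu> sequentially"
    and a: "ereal a < inf_potential \<mu>"
  shows "\<forall>\<^sub>F n in sequentially. ereal a \<le> inf_potential (\<mu>s n)"
proof -
  have \<mu>: "\<mu> \<in> prob_measures" using limitin_topspace[OF lim] by (simp add: topspace_weak_topology)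
  obtain a' where a': "a < a'" "ereal a' < inf_potential \<mu>"
    using ereal_dense2[OF a] by auto
  obtain k F where F: "finite F" "\<And>\<mu>' x. \<mu>' \<in> prob_measures \<Longrightarrow> x \<in> K \<Longrightarrow>
    a' - (\<Sum>c\<in>F. \<bar>pot k \<mu> c - pot k \<mu>' c\<bar>) \<le> pot k \<mu>' x"
    by (rule inf_potential_test_family[OF \<mu> a'(2)]) (rule that; assumption)
  have "(\<lambda>n. pot k (\<mu>s n) c) \<longlonglongrightarrow> pot k \<mu> c" for c
    using continuous_map_limit[OF continuous_map_weak_integral[OF compact
          continuous_kernel.continuous_section[OF kernel]] lim, of k c]
    by (simp add: comp_def pot_def)
  then have "(\<lambda>n. a' - (\<Sum>c\<in>F. \<bar>pot k \<mu> c - pot k (\<mu>s n) c\<bar>)) \<longlonglongrightarrow> a' - (\<Sum>c\<in>F. \<bar>pot k \<mu> c - pot k \<mu> c\<bar>)"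
    by (intro tendsto_intros)
  then have "\<forall>\<^sub>F n in sequentially. a < a' - (\<Sum>c\<in>F. \<bar>pot k \<mu> c - pot k (\<mu>s n) c\<bar>)"
    using a'(1) by (intro order_tendstoD) auto
  then show ?thesis
  proof eventually_elim
    case (elim n)
    show ?case
    proof (rule INF_greatest)
      fix x assume "x \<in> K"
      then have "a \<le> pot k (\<mu>s n) x" using F(2)[OF \<mu>s, of x n] elim by linarith
      then show "ereal a \<le> potential G (\<mu>s n) x"
        using pot_le_potential[OF \<mu>s, of k n x] by (meson ereal_less_eq(3) order_trans)
    qed
  qed
qed

text \<open>The test family gives information only at levels a strictly below the infimum; letting a
  increase to it recovers the limit functional.\<close>

lemma le_conditional_limitI:
  assumes \<mu>: "\<mu> \<in> prob_measures" and e: "interaction_energy G \<mu> = ereal e"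
    and X: "\<And>a. ereal a < inf_potential \<mu> \<Longrightarrow> X \<le> ereal (e / 2 - a)"
  shows "X \<le> conditional_limit G K \<mu>"
proof -
  obtain i where i: "inf_potential \<mu> = ereal i" using inf_potential_finite[OF \<mu>] by auto
  have "X \<le> ereal (e / 2 - i)"
  proof (rule ereal_le_epsilon2)
    fix d :: real assume "0 < d"
    then have "ereal (i - d) < inf_potential \<mu>" by (simp add: i)
    then have "X \<le> ereal (e / 2 - (i - d))" by (rule X)
    also have "e / 2 - (i - d) = e / 2 - i + d" by simp
    finally show "X \<le> ereal (e / 2 - i) + ereal d" by simp
  qed
  then show ?thesis using i e by (simp add: conditional_limit_def)
qed

text \<open>As \<open>\<nu>\<close> is carried by its support K, the field is at least n b almost
  everywhere, which bounds the integrand.\<close>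

lemma ln_mass_le:
  assumes "0 < n" and b: "\<And>y. y \<in> K \<Longrightarrow> b \<le> pot k (empirical_measure n z) y"
  shows "ln_ennreal (mass n z) \<le> ereal (- real n * b)"
proof (rule ln_ennreal_le)
  interpret prob_space \<nu> by (rule prob_measuresD[OF \<nu>])
  have "AE y in \<nu>. y \<in> K"
    unfolding K by (rule AE_measure_support[OF compact prob_measuresD(2)[OF \<nu>]])
  then have "AE y in \<nu>. exp_ereal (- (\<Sum>i<n. G y (z i))) \<le> ennreal (exp (- real n * b))"
  proof eventually_elim
    case (elim y)
    have "real n * b \<le> (\<Sum>i<n. f k y (z i))"
      using b[OF elim] assms(1) by (simp add: pot_def integral_f_empirical field_simps)
    then have "ereal (real n * b) \<le> ereal (\<Sum>i<n. f k y (z i))" by simp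
    also have "\<dots> \<le> (\<Sum>i<n. G y (z i))"
      unfolding sum_ereal[symmetric] by (intro sum_mono f_le_G)
    finally have "- (\<Sum>i<n. G y (z i)) \<le> ereal (- real n * b)"
      using ereal_minus_le_minus by fastforce
    then show ?case using exp_ereal_mono by (fastforce simp: exp_ereal_def)
  qed
  then have "mass n z \<le> (\<integral>\<^sup>+ y. ennreal (exp (- real n * b)) \<partial>\<nu>)"
    unfolding mass_def by (rule nn_integral_mono_AE)
  then show "mass n z \<le> ennreal (exp (- real n * b))" by (simp add: emeasure_space_1)
qed

text \<open>By independence each of the n (n - 1) / 2 pairs has expectation equal to the energy. The
  bounded term \<open>r\<close> stays inside the monotone approximation, so additivity of
  \<open>ext_integral\<close> is never invoked.\<close>

lemma expected_pair_energy_add: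
  assumes \<mu>: "\<mu> \<in> prob_measures" and n: "0 < n"
    and r[measurable]: "r \<in> borel_measurable (PiM {..<n} (\<lambda>_. \<mu>))" and rb: "\<And>z. \<bar>r z\<bar> \<le> b"
    and e: "interaction_energy G \<mu> = ereal e"
  shows "ext_integral (PiM {..<n} (\<lambda>_. \<mu>)) (\<lambda>z. ereal (1 / real n ^ 2) * pair_energy n z + ereal (r z)) =
    ereal ((real n - 1) / (2 * real n) * e + (\<integral>z. r z \<partial>(PiM {..<n} (\<lambda>_. \<mu>))))"
proof -
  let ?P = "PiM {..<n} (\<lambda>_. \<mu>)"
  interpret prob_space \<mu> by (rule prob_measuresD[OF \<mu>])
  interpret P: prob_space ?P by (intro prob_space_PiM prob_space_axioms)
  define h where "h k z = 1 / real n ^ 2 * (\<Sum>j<n. \<Sum>i<j. f k (z i) (z j)) + r z" for k and z :: "nat \<Rightarrow> 'a"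
  have meas_f: "(\<lambda>(x, y). f k x y) \<in> borel_measurable (\<mu> \<Otimes>\<^sub>M \<mu>)" for k
    using continuous_kernel.integrable_pair[OF kernel \<mu> \<mu>] by (rule borel_measurable_integrable)
  have proj: "(\<lambda>z. (z i, z j)) \<in> measurable ?P (\<mu> \<Otimes>\<^sub>M \<mu>)" if "i < n" "j < n" for i j
    by (intro measurable_Pair; rule measurable_component_singleton) (use that in auto)
  have meas: "(\<lambda>z. f k (z i) (z j)) \<in> borel_measurable ?P" if "i < n" "j < n" for k i j
    using measurable_compose[OF proj[OF that] meas_f[of k]] by simp
  have fb: "\<bar>f k x y\<bar> \<le> B + real k" for k x y
    using f_low[of k x y] f_up[of k x y] B by (auto simp: abs_le_iff)
  have int: "integrable ?P (\<lambda>z. f k (z i) (z j))" if "i < n" "j < n" for k i j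
    by (rule P.integrable_const_bound[where B="B + real k"]) (use fb meas[OF that] in auto)
  have pair: "(\<integral>z. f k (z i) (z j) \<partial>?P) = energy k \<mu>" if ij: "i < n" "j < n" "i \<noteq> j" for k i j
  proof -
    have "(\<integral>z. f k (z i) (z j) \<partial>?P) =
        (\<integral>p. (case p of (x, y) \<Rightarrow> f k x y) \<partial>(distr ?P (\<mu> \<Otimes>\<^sub>M \<mu>) (\<lambda>z. (z i, z j))))"
      by (subst integral_distr[OF proj[OF ij(1,2)] meas_f]) simp
    also have "\<dots> = (\<integral>p. (case p of (x, y) \<Rightarrow> f k x y) \<partial>(\<mu> \<Otimes>\<^sub>M \<mu>))"
      by (subst distr_PiM_two_components[OF prob_space_axioms]) (use ij in auto)
    finally show ?thesis
      unfolding energy_def pot_def continuous_kernel.Fubini(2)[OF kernel \<mu> \<mu>] .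
  qed
  have b0: "0 \<le> b" using rb[of undefined] by linarith
  have rint: "integrable ?P r" by (rule P.integrable_const_bound[where B=b]) (use rb in auto)
  have pint: "integrable ?P (\<lambda>z. \<Sum>j<n. \<Sum>i<j. f k (z i) (z j))" for k
    by (intro Bochner_Integration.integrable_sum int) auto
  have hint: "(\<integral>z. h k z \<partial>?P) = (real n - 1) / (2 * real n) * energy k \<mu> + (\<integral>z. r z \<partial>?P)" for k
  proof -
    have "(\<integral>z. (\<Sum>j<n. \<Sum>i<j. f k (z i) (z j)) \<partial>?P) = (\<Sum>j<n. \<integral>z. (\<Sum>i<j. f k (z i) (z j)) \<partial>?P)"
      by (intro Bochner_Integration.integral_sum Bochner_Integration.integrable_sum int) auto
    also have "\<dots> = (\<Sum>j<n. \<Sum>i<j. \<integral>z. f k (z i) (z j) \<partial>?P)"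
      by (intro sum.cong refl Bochner_Integration.integral_sum int) auto
    also have "\<dots> = (\<Sum>j<n. \<Sum>i<j. energy k \<mu>)" by (intro sum.cong refl pair) auto
    also have "\<dots> = real n * (real n - 1) / 2 * energy k \<mu>" by (rule pair_sum_const)
    finally have S: "(\<integral>z. (\<Sum>j<n. \<Sum>i<j. f k (z i) (z j)) \<partial>?P) = real n * (real n - 1) / 2 * energy k \<mu>" .
    have "(\<integral>z. h k z \<partial>?P) = 1 / real n ^ 2 * (\<integral>z. (\<Sum>j<n. \<Sum>i<j. f k (z i) (z j)) \<partial>?P) + (\<integral>z. r z \<partial>?P)"
      unfolding h_def using rint pint[of k] by simp
    also have "\<dots> = (real n - 1) / (2 * real n) * energy k \<mu> + (\<integral>z. r z \<partial>?P)"
      unfolding S using n by (simp add: power2_eq_square)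
    finally show ?thesis .
  qed
  have "(\<lambda>k. ereal (\<integral>z. h k z \<partial>?P)) \<longlonglongrightarrow>
      ext_integral ?P (\<lambda>z. ereal (1 / real n ^ 2) * pair_energy n z + ereal (r z))"
  proof (rule ext_integral_monotone_convergence)
    show "prob_space ?P" by (rule P.prob_space_axioms)
    show "h k \<in> borel_measurable ?P" for k
      unfolding h_def using pint[of k] by (intro borel_measurable_add borel_measurable_times) auto
    \<comment> \<open>The number of pairs is bounded crudely by n^2, which cancels the normalisation
      and keeps both bounds on \<open>h k\<close> free of n.\<close>
    have scale: "1 / real n ^ 2 * (real n * (real n * c)) = c" for c
      using n by (simp add: power2_eq_square)
    show "- (B + b) \<le> h k z" for k z
    proof -
      have "(\<Sum>j<n. \<Sum>i<j. - B) \<le> (\<Sum>j<n. \<Sum>i<j. f k (z i) (z j))" by (intro sum_mono f_low)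
      moreover have "- (real n * (real n * B)) \<le> (\<Sum>j<n. \<Sum>i<j. - B)"
        using pair_sum_bound[of "\<lambda>_ _. - B" B n] B by simp
      ultimately have "1 / real n ^ 2 * (- (real n * (real n * B))) \<le>
          1 / real n ^ 2 * (\<Sum>j<n. \<Sum>i<j. f k (z i) (z j))"
        by (intro mult_left_mono) auto
      then have "- B \<le> 1 / real n ^ 2 * (\<Sum>j<n. \<Sum>i<j. f k (z i) (z j))"
        using scale[of B] by simp
      then show ?thesis unfolding h_def using rb[of z] by linarith
    qed
    show "0 \<le> B + b" using B b0 by simp
    show "h k z \<le> B + real k + b" for k z
    proof -
      have "1 / real n ^ 2 * (\<Sum>j<n. \<Sum>i<j. f k (z i) (z j)) \<le> 1 / real n ^ 2 * (real n * (real n * (B + real k)))"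
        using pair_sum_bound[of "\<lambda>i j. f k (z i) (z j)" "B + real k" n] fb B
        by (intro mult_left_mono) auto
      then show ?thesis unfolding h_def scale using rb[of z] by linarith
    qed
    show "incseq (\<lambda>k. h k z)" for z
      unfolding h_def incseq_def using f_incseq
      by (auto simp: incseq_def intro!: add_right_mono divide_right_mono sum_mono)
    fix z
    have "(\<lambda>k. ereal (\<Sum>j<n. \<Sum>i<j. f k (z i) (z j))) \<longlonglongrightarrow> pair_energy n z"
      unfolding pair_energy_def
    proof (rule tendsto_ereal_sum[of n "\<lambda>k j. \<Sum>i<j. f k (z i) (z j)" "\<lambda>j. \<Sum>i<j. G (z i) (z j)"])
      show "(\<lambda>k. ereal (\<Sum>i<j. f k (z i) (z j))) \<longlonglongrightarrow> (\<Sum>i<j. G (z i) (z j))" for j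
        by (rule tendsto_ereal_sum[of j "\<lambda>k i. f k (z i) (z j)" "\<lambda>i. G (z i) (z j)"])
           (auto simp: f_lim G_not_MInfty)
      show "(\<Sum>i<j. G (z i) (z j)) \<noteq> - \<infinity>" for j by (intro ereal_sum_not_MInfty G_not_MInfty)
    qed
    then have "(\<lambda>k. ereal (1 / real n ^ 2) * ereal (\<Sum>j<n. \<Sum>i<j. f k (z i) (z j)) + ereal (r z)) \<longlonglongrightarrow>
        ereal (1 / real n ^ 2) * pair_energy n z + ereal (r z)"
      by (intro tendsto_add_ereal_general tendsto_cmult_ereal tendsto_const) auto
    then show "(\<lambda>k. ereal (h k z)) \<longlonglongrightarrow> ereal (1 / real n ^ 2) * pair_energy n z + ereal (r z)"
      by (simp add: h_def)
  qed
  moreover have "(\<lambda>k. energy k \<mu>) \<longlonglongrightarrow> e" using energy_tendsto[OF \<mu>] e by simp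
  then have "(\<lambda>k. (real n - 1) / (2 * real n) * energy k \<mu> + (\<integral>z. r z \<partial>?P)) \<longlonglongrightarrow>
      (real n - 1) / (2 * real n) * e + (\<integral>z. r z \<partial>?P)" by (intro tendsto_intros)
  then have "(\<lambda>k. ereal (\<integral>z. h k z \<partial>?P)) \<longlonglongrightarrow>
      ereal ((real n - 1) / (2 * real n) * e + (\<integral>z. r z \<partial>?P))"
    unfolding hint by simp
  ultimately show ?thesis by (rule LIMSEQ_unique)
qed

text \<open>If the energy is infinite, so is the right side. Otherwise the logarithmic term is
  bounded pointwise by finitely many fluctuations of averages, whose expectations are of order 1 /
  sqrt n.\<close>

lemma limsup_expected_energy:
  assumes \<mu>: "\<mu> \<in> prob_measures"
  shows "limsup (\<lambda>n. ext_integral (PiM {..<n} (\<lambda>_. \<mu>)) (conditional_energy G \<nu> n)) \<le>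
    conditional_limit G K \<mu>"
proof (cases "interaction_energy G \<mu> = \<infinity>")
  case True
  then show ?thesis using inf_potential_finite[OF \<mu>] by (simp add: conditional_limit_def)
next
  case False
  then obtain e where e: "interaction_energy G \<mu> = ereal e"
    using interaction_energy_low[OF \<mu>] by (cases "interaction_energy G \<mu>") auto
  interpret prob_space \<mu> by (rule prob_measuresD[OF \<mu>])
  show ?thesis
  proof (rule le_conditional_limitI[OF \<mu> e])
    fix a assume a: "ereal a < inf_potential \<mu>"
    obtain k F where F: "finite F" "\<And>\<mu>' x. \<mu>' \<in> prob_measures \<Longrightarrow> x \<in> K \<Longrightarrow>
        a - (\<Sum>c\<in>F. \<bar>pot k \<mu> c - pot k \<mu>' c\<bar>) \<le> pot k \<mu>' x"
      by (rule inf_potential_test_family[OF \<mu> a]) (rule that; assumption)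
    obtain b where b: "0 \<le> b" "\<And>x y. \<bar>f k x y\<bar> \<le> b" using continuous_kernel.bound[OF kernel] by metis
    define R where "R n z = (\<Sum>c\<in>F. \<bar>(\<Sum>i<n. f k c (z i)) / real n - pot k \<mu> c\<bar>)" for n and z :: "nat \<Rightarrow> 'a"
    \<comment> \<open>The first summand is the exact expected pair energy; the second is the
      expectation of the bound on the logarithmic term, with 2b / sqrt n for each point of
      F.\<close>
    define q where "q n = (real n - 1) / (2 * real n) * e +
      real (n + 1) / real n * (real (card F) * (2 * b / sqrt (real n)) - a)" for n :: nat
    have bound: "ext_integral (PiM {..<n} (\<lambda>_. \<mu>)) (conditional_energy G \<nu> n) \<le> ereal (q n)"
      if n: "0 < n" for n
    proof -
      let ?P = "PiM {..<n} (\<lambda>_. \<mu>)"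
      interpret P: prob_space ?P by (intro prob_space_PiM prob_space_axioms)
      have meas_f: "f k c \<in> borel_measurable \<mu>" for c
        using integrable_f[OF \<mu>] by (rule borel_measurable_integrable)
      have meas_c: "(\<lambda>z. \<bar>(\<Sum>i<n. f k c (z i)) / real n - pot k \<mu> c\<bar>) \<in> borel_measurable ?P" for c
        using meas_f[of c] by measurable
      have avg: "\<bar>(\<Sum>i<n. f k c (z i)) / real n\<bar> \<le> b" for c z
      proof -
        have "\<bar>\<Sum>i<n. f k c (z i)\<bar> \<le> (\<Sum>i<n. b)" by (rule order_trans[OF sum_abs sum_mono]) (rule b(2))
        then show ?thesis using n by (simp add: divide_le_eq mult.commute)
      qed
      have "\<bar>pot k \<mu> c\<bar> \<le> b" for c
      proof -
        have "\<bar>pot k \<mu> c\<bar> \<le> (\<integral>y. \<bar>f k c y\<bar> \<partial>\<mu>)" unfolding pot_def by (rule integral_abs_bound)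
        also have "\<dots> \<le> (\<integral>y. b \<partial>\<mu>)" by (intro integral_mono) (use b integrable_f[OF \<mu>] in auto)
        finally show ?thesis by (simp add: prob_space)
      qed
      then have dev: "\<bar>(\<Sum>i<n. f k c (z i)) / real n - pot k \<mu> c\<bar> \<le> 2 * b" for c z
        using avg[of c z] by (smt (verit) abs_triangle_ineq4)
      have int_c: "integrable ?P (\<lambda>z. \<bar>(\<Sum>i<n. f k c (z i)) / real n - pot k \<mu> c\<bar>)" for c
        by (rule P.integrable_const_bound[where B="2 * b"]) (use dev meas_c in auto)
      have R: "0 \<le> R n z" "R n z \<le> real (card F) * (2 * b)" for z
      proof -
        show "0 \<le> R n z" unfolding R_def by (intro sum_nonneg) auto
        have "R n z \<le> (\<Sum>c\<in>F. 2 * b)" unfolding R_def by (intro sum_mono dev)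
        then show "R n z \<le> real (card F) * (2 * b)" by simp
      qed
      have intR: "integrable ?P (R n)"
        unfolding R_def by (intro Bochner_Integration.integrable_sum int_c)
      have "(\<integral>z. R n z \<partial>?P) = (\<Sum>c\<in>F. \<integral>z. \<bar>(\<Sum>i<n. f k c (z i)) / real n - pot k \<mu> c\<bar> \<partial>?P)"
        unfolding R_def by (intro Bochner_Integration.integral_sum int_c)
      also have "\<dots> \<le> (\<Sum>c\<in>F. 2 * b / sqrt (real n))"
        unfolding pot_def by (intro sum_mono integral_average_deviation_le meas_f b n)
      finally have ER: "(\<integral>z. R n z \<partial>?P) \<le> real (card F) * (2 * b / sqrt (real n))" by simp
      \<comment> \<open>On K the potential \<open>pot k\<close> of the empirical measure is at least
        a - R, so the logarithm is at most -n (a - R); multiplying by (n + 1) / n^2 gives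
        \<open>r\<close>.\<close>
      define r where "r z = real (n + 1) / real n * (R n z - a)" for z :: "nat \<Rightarrow> 'a"
      have "conditional_energy G \<nu> n z \<le> ereal (1 / real n ^ 2) * pair_energy n z + ereal (r z)" for z
      proof -
        have "pot k (empirical_measure n z) c = (\<Sum>i<n. f k c (z i)) / real n" for c
          by (simp add: pot_def integral_f_empirical)
        then have "a - R n z \<le> pot k (empirical_measure n z) y" if "y \<in> K" for y
          using F(2)[OF empirical_measure_prob[OF n, of z] that] by (simp add: R_def abs_minus_commute)
        then have "ln_ennreal (mass n z) \<le> ereal (- real n * (a - R n z))"
          by (rule ln_mass_le[OF n])
        then have "ereal (real (n + 1) / real n ^ 2) * ln_ennreal (mass n z) \<le>
            ereal (real (n + 1) / real n ^ 2) * ereal (- real n * (a - R n z))"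
          by (intro ereal_mult_left_mono) auto
        also have "\<dots> = ereal (r z)"
          using n by (simp add: r_def field_simps power2_eq_square)
        finally show ?thesis unfolding conditional_energy_alt by (intro add_left_mono)
      qed
      then have "ext_integral ?P (conditional_energy G \<nu> n) \<le>
          ext_integral ?P (\<lambda>z. ereal (1 / real n ^ 2) * pair_energy n z + ereal (r z))"
        by (intro ext_integral_mono_AE) auto
      also have "\<dots> = ereal ((real n - 1) / (2 * real n) * e + (\<integral>z. r z \<partial>?P))"
      proof (rule expected_pair_energy_add[OF \<mu> n _ _ e])
        show "r \<in> borel_measurable ?P"
          unfolding r_def using borel_measurable_integrable[OF intR] by measurable
        show "\<bar>r z\<bar> \<le> real (n + 1) / real n * (real (card F) * (2 * b) + \<bar>a\<bar>)" for z
          unfolding r_def abs_mult using R[of z] by (intro mult_mono) auto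
      qed
      also have "(\<integral>z. r z \<partial>?P) = real (n + 1) / real n * ((\<integral>z. R n z \<partial>?P) - a)"
        unfolding r_def using intR by (simp add: P.prob_space)
      also have "ereal ((real n - 1) / (2 * real n) * e + real (n + 1) / real n * ((\<integral>z. R n z \<partial>?P) - a)) \<le> ereal (q n)"
        unfolding q_def ereal_less_eq(3) by (intro add_left_mono mult_left_mono diff_right_mono ER) auto
      finally show ?thesis .
    qed
    have "(\<lambda>n. (real n - 1) / (2 * real n)) \<longlonglongrightarrow> 1 / 2" by real_asymp
    moreover have "(\<lambda>n. real (n + 1) / real n) \<longlonglongrightarrow> 1" by real_asymp
    moreover have "(\<lambda>n. 2 * b / sqrt (real n)) \<longlonglongrightarrow> 0" by real_asymp
    ultimately have "q \<longlonglongrightarrow> 1 / 2 * e + 1 * (real (card F) * 0 - a)"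
      unfolding q_def by (intro tendsto_add tendsto_mult tendsto_diff tendsto_const)
    then have "(\<lambda>n. ereal (q n)) \<longlonglongrightarrow> ereal (e / 2 - a)" by simp
    then have "limsup (\<lambda>n. ereal (q n)) = ereal (e / 2 - a)"
      by (intro lim_imp_Limsup) auto
    moreover have "limsup (\<lambda>n. ext_integral (PiM {..<n} (\<lambda>_. \<mu>)) (conditional_energy G \<nu> n)) \<le>
        limsup (\<lambda>n. ereal (q n))"
      by (intro Limsup_mono eventually_mono[OF eventually_gt_at_top[of 0]] bound)
    ultimately show "limsup (\<lambda>n. ext_integral (PiM {..<n} (\<lambda>_. \<mu>)) (conditional_energy G \<nu> n)) \<le>
        ereal (e / 2 - a)" by simp
  qed
qed

text \<open>The energies converge by assumption, so what remains is that the infimum of the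
  potential cannot drop in the limit.\<close>

lemma limsup_conditional_limit:
  assumes \<mu>s: "\<And>n. \<mu>s n \<in> prob_measures" and lim: "limitin weak_topology \<mu>s \<mu> sequentially"
    and E: "(\<lambda>n. interaction_energy G (\<mu>s n)) \<longlonglongrightarrow> interaction_energy G \<mu>"
    and fin: "interaction_energy G \<mu> < \<infinity>"
  shows "limsup (\<lambda>n. conditional_limit G K (\<mu>s n)) \<le> conditional_limit G K \<mu>"
proof -
  have \<mu>: "\<mu> \<in> prob_measures" using limitin_topspace[OF lim] by (simp add: topspace_weak_topology)
  obtain e where e: "interaction_energy G \<mu> = ereal e"
    using interaction_energy_low[OF \<mu>] fin by (cases "interaction_energy G \<mu>") auto
  show ?thesis
  proof (rule le_conditional_limitI[OF \<mu> e])
    fix a assume a: "ereal a < inf_potential \<mu>"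
    have "(\<lambda>n. ereal (1 / 2) * interaction_energy G (\<mu>s n) - ereal a) \<longlonglongrightarrow> ereal (1 / 2) * ereal e - ereal a"
      using E unfolding e by (intro tendsto_diff_ereal_general tendsto_cmult_ereal tendsto_const) auto
    then have "limsup (\<lambda>n. ereal (1 / 2) * interaction_energy G (\<mu>s n) - ereal a) = ereal (1 / 2) * ereal e - ereal a"
      by (intro lim_imp_Limsup) auto
    moreover have "limsup (\<lambda>n. conditional_limit G K (\<mu>s n)) \<le>
        limsup (\<lambda>n. ereal (1 / 2) * interaction_energy G (\<mu>s n) - ereal a)"
    proof (rule Limsup_mono)
      show "\<forall>\<^sub>F n in sequentially. conditional_limit G K (\<mu>s n) \<le>
          ereal (1 / 2) * interaction_energy G (\<mu>s n) - ereal a"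
        using eventually_inf_potential_greater[OF \<mu>s lim a]
        by eventually_elim (auto simp: conditional_limit_def intro: ereal_minus_mono)
    qed
    ultimately show "limsup (\<lambda>n. conditional_limit G K (\<mu>s n)) \<le> ereal (e / 2 - a)" by simp
  qed
qed

lemma interaction_energy_finite:
  assumes "\<mu> \<in> prob_measures" "conditional_limit G K \<mu> < \<infinity>"
  shows "interaction_energy G \<mu> < \<infinity>"
  using assms(2) inf_potential_finite[OF assms(1)]
  by (cases "interaction_energy G \<mu>") (auto simp: conditional_limit_def)

text \<open>The expected-energy bound holds at every probability measure, so finite relative entropy
  alone places the approximating measures in \<open>recovery_measures\<close>.\<close>

lemma zero_temp_macroscopic_limit_conditional:
  assumes approx: "\<And>\<mu>. \<mu> \<in> prob_measures \<Longrightarrow> interaction_energy G \<mu> < \<infinity> \<Longrightarrow>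
      \<exists>\<mu>s :: nat \<Rightarrow> 'a measure. (\<forall>n. \<mu>s n \<in> prob_measures \<and> rel_entropy (\<mu>s n) \<pi> < \<infinity>) \<and>
        limitin weak_topology \<mu>s \<mu> sequentially \<and>
        (\<lambda>n. interaction_energy G (\<mu>s n)) \<longlonglongrightarrow> interaction_energy G \<mu>"
  shows "zero_temp_macroscopic_limit \<pi> (conditional_energy G \<nu>) (conditional_limit G K)"
  unfolding zero_temp_macroscopic_limit_def
proof (intro conjI)
  show "\<forall>n>0. energy_function n (conditional_energy G \<nu> n)"
    using energy_function_conditional_energy by blast
  show "conditional_limit G K \<in> borel_measurable weak_borel" by (rule measurable_conditional_limit)
  show "\<forall>\<mu>\<in>prob_measures. conditional_limit G K \<mu> \<noteq> - \<infinity>"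
    using conditional_limit_not_MInfty by blast
  show "\<exists>C::real. \<forall>n>0. \<forall>x\<in>space (power_space n). ereal C \<le> conditional_energy G \<nu> n x"
    by (rule conditional_energy_stable)
  show "\<forall>\<mu>s \<mu>. (\<forall>n. \<mu>s n \<in> prob_measures) \<and> limitin weak_topology \<mu>s \<mu> sequentially \<longrightarrow>
      conditional_limit G K \<mu> \<le> liminf (\<lambda>n. lift_energy n (conditional_energy G \<nu> n) (\<mu>s n))"
    using liminf_lift_energy by blast
  show "\<forall>\<mu>\<in>prob_measures. conditional_limit G K \<mu> < \<infinity> \<longrightarrow>
      (\<exists>\<mu>s. (\<forall>n. \<mu>s n \<in> recovery_measures \<pi> (conditional_energy G \<nu>) (conditional_limit G K)) \<and>
        limitin weak_topology \<mu>s \<mu> sequentially \<and>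
        limsup (\<lambda>n. conditional_limit G K (\<mu>s n)) \<le> conditional_limit G K \<mu>)"
  proof (intro ballI impI)
    fix \<mu> :: "'a measure"
    assume \<mu>: "\<mu> \<in> prob_measures" and w: "conditional_limit G K \<mu> < \<infinity>"
    note fin = interaction_energy_finite[OF \<mu> w]
    obtain \<mu>s where \<mu>s: "\<And>n. \<mu>s n \<in> prob_measures" "\<And>n. rel_entropy (\<mu>s n) \<pi> < \<infinity>"
        "limitin weak_topology \<mu>s \<mu> sequentially"
        "(\<lambda>n. interaction_energy G (\<mu>s n)) \<longlonglongrightarrow> interaction_energy G \<mu>"
      using approx[OF \<mu> fin] by blast
    show "\<exists>\<mu>s. (\<forall>n. \<mu>s n \<in> recovery_measures \<pi> (conditional_energy G \<nu>) (conditional_limit G K)) \<and>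
        limitin weak_topology \<mu>s \<mu> sequentially \<and>
        limsup (\<lambda>n. conditional_limit G K (\<mu>s n)) \<le> conditional_limit G K \<mu>"
    proof (intro exI conjI allI)
      show "\<mu>s n \<in> recovery_measures \<pi> (conditional_energy G \<nu>) (conditional_limit G K)" for n
        using \<mu>s limsup_expected_energy[OF \<mu>s(1)] by (simp add: recovery_measures_def)
      show "limitin weak_topology \<mu>s \<mu> sequentially" by fact
      show "limsup (\<lambda>n. conditional_limit G K (\<mu>s n)) \<le> conditional_limit G K \<mu>"
        by (rule limsup_conditional_limit[OF \<mu>s(1,3,4) fin])
    qed
  qed
qed

end

text \<open>Symmetry of \<open>G\<close> underlies both the permutation invariance of the energies
  and the reciprocity of potentials. The approximating sequence is taken weakly convergent, which is
  the convergence required of recovery sequences.\<close>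

theorem corollary4p18:
  fixes G :: "'a::metric_space \<Rightarrow> 'a \<Rightarrow> ereal"
    and \<pi> \<nu> :: "'a measure" and K :: "'a set"
  assumes compact: "compact (UNIV :: 'a set)"
    and \<pi>: "\<pi> \<in> prob_measures" and \<nu>: "\<nu> \<in> prob_measures"
    and K: "K = measure_support \<nu>"
    and G_not_MInf: "\<And>x y. G x y \<noteq> - \<infinity>"
    and G_lsc: "lower_semicontinuous (\<lambda>(x, y). G x y)"
    and G_sym: "\<And>x y. G x y = G y x"
    and regular: "regular_pair G K"
    and BM: "bernstein_markov G K \<nu>"
    and approx: "\<And>\<mu>. \<mu> \<in> prob_measures \<Longrightarrow> interaction_energy G \<mu> < \<infinity> \<Longrightarrow>
      \<exists>\<mu>s :: nat \<Rightarrow> 'a measure. (\<forall>n. \<mu>s n \<in> prob_measures \<and> rel_entropy (\<mu>s n) \<pi> < \<infinity>) \<and>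
        limitin weak_topology \<mu>s \<mu> sequentially \<and>
        (\<lambda>n. interaction_energy G (\<mu>s n)) \<longlonglongrightarrow> interaction_energy G \<mu>"
  shows "zero_temp_macroscopic_limit \<pi> (conditional_energy G \<nu>) (conditional_limit G K)"
proof -
  obtain B where B: "0 \<le> B" "\<And>p. ereal (- B) \<le> (case p of (x, y) \<Rightarrow> G x y)"
    by (rule lower_semicontinuous_bounded_below[OF _ G_lsc])
       (use compact_Times[OF compact compact] G_not_MInf in auto)
  obtain g :: "nat \<Rightarrow> 'a \<times> 'a \<Rightarrow> real" where g: "\<And>k. continuous_on UNIV (g k)"
    "\<And>k p. - B \<le> g k p" "\<And>k p. g k p \<le> real k" "\<And>p. incseq (\<lambda>k. g k p)"
    "\<And>p. (\<lambda>k. ereal (g k p)) \<longlonglongrightarrow> (case p of (x, y) \<Rightarrow> G x y)"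
    by (rule lower_semicontinuous_approx[OF G_lsc B]) (rule that; assumption)
  \<comment> \<open>The minimum with the swapped kernel is symmetric and keeps continuity,
    monotonicity and both bounds; its limit is still \<open>G\<close> because \<open>G\<close> is
    symmetric.\<close>
  define f where "f k x y = min (g k (x, y)) (g k (y, x))" for k x y
  interpret conditional_gas G f B K \<nu>
  proof
    have "continuous_on UNIV (\<lambda>p. g k (prod.swap p))" for k
      by (rule continuous_on_compose2[OF g(1) continuous_on_swap]) auto
    then show "continuous_on UNIV (\<lambda>(x, y). f k x y)" for k
      unfolding f_def case_prod_beta' using g(1)[of k]
      by (intro continuous_on_min) (simp_all add: prod.swap_def)
    show "(\<lambda>k. ereal (f k x y)) \<longlonglongrightarrow> G x y" for x y
      using tendsto_min[OF g(5)[of "(x, y)"] g(5)[of "(y, x)"]] G_sym[of y x]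
      by (simp add: f_def flip: ereal_min)
    show "incseq (\<lambda>k. f k x y)" for x y
      using g(4)[of "(x, y)"] g(4)[of "(y, x)"]
      unfolding f_def incseq_def by (meson min.mono)
  qed (use compact \<nu> K regular BM B(1) g(2,3) in \<open>auto simp: f_def min.commute min_le_iff_disj\<close>)
  show ?thesis by (rule zero_temp_macroscopic_limit_conditional[OF approx])
qed

end
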